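(* Let $A$ be a finite set and let $G$ be a countable sofic group. Suppose that $X \subset A^G$ is a splicable (e.g., of finite type) strongly irreducible subshift. Assume that $h_\Sigma(X,G) \geq 0$ for some sofic approximation $\Sigma$ of $G$. Then $(X,G)$ is surjunctive, i.e., every injective continuous $G$-equivariant map $f\colon X\to X$ is surjective.
   Context: For a finite set $A$ and a countable group $G$, $A^G$ carries the product topology of the discrete topologies on $A$ (so it is compact metrizable) and the shift action $(gx)(h)=x(g^{-1}h)$ for $g,h\in G$, $x\in A^G$. A subshift is a closed $G$-invariant subset $X\subset A^G$; $(X,G)$ denotes $X$ with the induced topology and the restricted action. A subshift $X\subset A^G$ is of finite type if there exist a finite subset $\Omega\subset G$ and $\mathcal A\subset A^\Omega$ such that $X=\{x\in A^G:(gx)|_\Omega\in\mathcal A\text{ for all }g\in G\}$. A subshift $X\subset A^G$ is splicable if there exists a finite subset $\Delta\subset G$ containing $1_G$ such that: given any finite subset $E\subset G$ and $x,y\in X$ with $x|_{E\Delta\setminus E}=y|_{E\Delta\setminus E}$, the configuration $z\in A^G$ with $z|_E=x|_E$ and $z|_{G\setminus E}=y|_{G\setminus E}$ belongs to $X$. (Every subshift of finite type is splicable.) A subshift $X\subset A^G$ is strongly irreducible if there exists a finite subset $\Delta\subset G$ containing $1_G$ such that: given finite subsets $E_1,E_2\subset G$ with $E_1\Delta\cap E_2=\varnothing$ and $x_1,x_2\in X$, there exists $z\in X$ with $z|_{E_1}=x_1|_{E_1}$ and $z|_{E_2}=x_2|_{E_2}$. Sofic approximations: for a positive integer $d$ write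 $[d]=\{1,\dots,d\}$, $\mathrm{Sym}(d)$ for the symmetric group of $[d]$, and $\eta_d(\sigma,\sigma') = \frac1d|\{a\in[d]:\sigma(a)\ne\sigma'(a)\}|$ for the normalized Hamming distance on $\mathrm{Sym}(d)$. A sofic approximation of a countable group $G$ is a sequence $\Sigma=(d_j,\sigma_j)_{j\in\mathbb N}$, where $d_j$ is a positive integer and $\sigma_j\colon G\to\mathrm{Sym}(d_j)$ is a map, such that $\lim_{j} d_j=+\infty$; $\lim_{j}\eta_{d_j}(\sigma_j(s)\sigma_j(t),\sigma_j(st))=0$ for all $s,t\in G$; and $\lim_{j}\eta_{d_j}(\sigma_j(s),\sigma_j(t))=1$ for all distinct $s,t\in G$. A countable group is sofic if it admits a sofic approximation. Sofic topological entropy: fix a metric $\rho$ on $X$ compatible with the topology (the entropy does not depend on this choice). For $\varphi,\psi\colon[d]\to X$ set $\rho_2(\varphi,\psi)=\big(\frac1d\sum_{a\in[d]}\rho(\varphi(a),\psi(a))^2\big)^{1/2}$ and $\rho_\infty(\varphi,\psi)=\max_{a\in[d]}\rho(\varphi(a),\psi(a))$. For a nonempty finite $F\subset G$, $\delta>0$, and a map $\sigma\colon G\to\mathrm{Sym}(d)$, $s \mapsto \sigma_s$, let $\mathrm{Map}(X,\rho,F,\delta,\sigma)$ be the set of all $\varphi\colon[d]\to X$ such that $\rho_2(\varphi\circ\sigma_s,s\varphi)<\delta$ for all $s\in F$, where $(s\varphi)(a)=s\varphi(a)$. For $\varepsilon>0$ let $N_\varepsilon(\mathrm{Map}(X,\rho,F,\delta,\sigma),\rho_\infty)$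 be the maximal cardinality of a subset of $\mathrm{Map}(X,\rho,F,\delta,\sigma)$ any two distinct elements of which are at $\rho_\infty$-distance $\ge\varepsilon$ (with $\log 0=-\infty$ when $\mathrm{Map}$ is empty). Then $$h_\Sigma(X,G)=\sup_{\varepsilon>0}\ \inf_{F}\ \inf_{\delta>0}\ \limsup_{j\to\infty}\frac1{d_j}\log N_\varepsilon(\mathrm{Map}(X,\rho,F,\delta,\sigma_j),\rho_\infty)\in\{-\infty\}\cup[0,\infty],$$ with $F$ ranging over nonempty finite subsets of $G$. *)

theory Defs
  imports "HOL-Analysis.Analysis" "HOL-Algebra.Coset"
begin

section \<open>Shifts and subshifts\<close>

text \<open>
  Configurations are extensional functions in \<open>carrier G \<rightarrow>\<^sub>E A\<close>, which is the
  underlying set of the following product space.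
\<close>

definition full_shift :: "('g, 'm) monoid_scheme \<Rightarrow> 'a set \<Rightarrow> ('g \<Rightarrow> 'a) topology" where
  "full_shift G A = product_topology (\<lambda>_. discrete_topology A) (carrier G)"

definition shift :: "('g, 'm) monoid_scheme \<Rightarrow> 'g \<Rightarrow> ('g \<Rightarrow> 'a) \<Rightarrow> 'g \<Rightarrow> 'a" where
  "shift G g x = (\<lambda>h\<in>carrier G. x (inv\<^bsub>G\<^esub> g \<otimes>\<^bsub>G\<^esub> h))"

definition subshift :: "('g, 'm) monoid_scheme \<Rightarrow> 'a set \<Rightarrow> ('g \<Rightarrow> 'a) set \<Rightarrow> bool" where
  "subshift G A X \<longleftrightarrow>
     closedin (full_shift G A) X \<and> (\<forall>g\<in>carrier G. \<forall>x\<in>X. shift G g x \<in> X)"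

definition finite_type :: "('g, 'm) monoid_scheme \<Rightarrow> 'a set \<Rightarrow> ('g \<Rightarrow> 'a) set \<Rightarrow> bool" where
  "finite_type G A X \<longleftrightarrow>
     (\<exists>\<Omega> P. finite \<Omega> \<and> \<Omega> \<subseteq> carrier G \<and> P \<subseteq> (\<Omega> \<rightarrow>\<^sub>E A) \<and>
        X = {x \<in> carrier G \<rightarrow>\<^sub>E A. \<forall>g\<in>carrier G. restrict (shift G g x) \<Omega> \<in> P})"

definition splicable :: "('g, 'm) monoid_scheme \<Rightarrow> ('g \<Rightarrow> 'a) set \<Rightarrow> bool" where
  "splicable G X \<longleftrightarrow>
     (\<exists>\<Delta>. finite \<Delta> \<and> \<Delta> \<subseteq> carrier G \<and> \<one>\<^bsub>G\<^esub> \<in> \<Delta> \<and>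
        (\<forall>E x y. finite E \<and> E \<subseteq> carrier G \<and> x \<in> X \<and> y \<in> X \<and>
           (\<forall>h \<in> (E <#>\<^bsub>G\<^esub> \<Delta>) - E. x h = y h) \<longrightarrow>
           (\<lambda>h. if h \<in> E then x h else y h) \<in> X))"

definition strongly_irreducible :: "('g, 'm) monoid_scheme \<Rightarrow> ('g \<Rightarrow> 'a) set \<Rightarrow> bool" where
  "strongly_irreducible G X \<longleftrightarrow>
     (\<exists>\<Delta>. finite \<Delta> \<and> \<Delta> \<subseteq> carrier G \<and> \<one>\<^bsub>G\<^esub> \<in> \<Delta> \<and>
        (\<forall>E1 E2 x1 x2. finite E1 \<and> E1 \<subseteq> carrier G \<and> finite E2 \<and> E2 \<subseteq> carrier G \<and>
           (E1 <#>\<^bsub>G\<^esub> \<Delta>) \<inter> E2 = {} \<and> x1 \<in> X \<and> x2 \<in> X \<longrightarrow>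
           (\<exists>z\<in>X. (\<forall>h\<in>E1. z h = x1 h) \<and> (\<forall>h\<in>E2. z h = x2 h))))"

definition surjunctive :: "('g, 'm) monoid_scheme \<Rightarrow> 'a set \<Rightarrow> ('g \<Rightarrow> 'a) set \<Rightarrow> bool" where
  "surjunctive G A X \<longleftrightarrow>
     (\<forall>f. continuous_map (subtopology (full_shift G A) X) (subtopology (full_shift G A) X) f \<and>
          inj_on f X \<and>
          (\<forall>g\<in>carrier G. \<forall>x\<in>X. f (shift G g x) = shift G g (f x)) \<longrightarrow>
          f ` X = X)"

lemma finite_type_imp_splicable:
  assumes "group G" and "finite_type G A X"
  shows "splicable G X"
proof -
  interpret group G by fact
  from assms(2) obtain \<Omega> P where fin: "finite \<Omega>" and sub: "\<Omega> \<subseteq> carrier G"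
    and X: "X = {x \<in> carrier G \<rightarrow>\<^sub>E A. \<forall>g\<in>carrier G. restrict (shift G g x) \<Omega> \<in> P}"
    unfolding finite_type_def by blast
  define \<Delta> where "\<Delta> = insert \<one>\<^bsub>G\<^esub> ((\<lambda>(s, t). inv\<^bsub>G\<^esub> s \<otimes>\<^bsub>G\<^esub> t) ` (\<Omega> \<times> \<Omega>))"
  have \<Delta>: "finite \<Delta>" "\<Delta> \<subseteq> carrier G" "\<one>\<^bsub>G\<^esub> \<in> \<Delta>"
    using fin sub by (auto simp: \<Delta>_def)
  have splice: "(\<lambda>h. if h \<in> E then x h else y h) \<in> X" (is "?z \<in> X")
    if E: "E \<subseteq> carrier G" and x: "x \<in> X" and y: "y \<in> X"
      and eq: "\<forall>h \<in> (E <#>\<^bsub>G\<^esub> \<Delta>) - E. x h = y h" for E x y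
  proof -
    have xyA: "x \<in> carrier G \<rightarrow>\<^sub>E A" "y \<in> carrier G \<rightarrow>\<^sub>E A"
      and xP: "\<And>g. g \<in> carrier G \<Longrightarrow> restrict (shift G g x) \<Omega> \<in> P"
      and yP: "\<And>g. g \<in> carrier G \<Longrightarrow> restrict (shift G g y) \<Omega> \<in> P"
      using x y unfolding X by simp_all
    have "?z \<in> carrier G \<rightarrow>\<^sub>E A"
    proof (rule PiE_I)
      show "?z h \<in> A" if "h \<in> carrier G" for h
        using that PiE_mem[OF xyA(1)] PiE_mem[OF xyA(2)] by simp
      show "?z h = undefined" if "h \<notin> carrier G" for h
        using that E PiE_arb[OF xyA(2)] by auto
    qed
    moreover have "restrict (shift G g ?z) \<Omega> \<in> P" if g: "g \<in> carrier G" for g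
    proof (cases "\<exists>w\<in>\<Omega>. inv\<^bsub>G\<^esub> g \<otimes>\<^bsub>G\<^esub> w \<in> E")
      case True
      then obtain w where w: "w \<in> \<Omega>" "inv\<^bsub>G\<^esub> g \<otimes>\<^bsub>G\<^esub> w \<in> E" by blast
      have "shift G g ?z t = shift G g x t" if t: "t \<in> \<Omega>" for t
      proof -
        have c: "w \<in> carrier G" "t \<in> carrier G" using w t sub by auto
        have "w \<otimes>\<^bsub>G\<^esub> (inv\<^bsub>G\<^esub> w \<otimes>\<^bsub>G\<^esub> t) = t"
          using c by (simp flip: m_assoc)
        then have "inv\<^bsub>G\<^esub> g \<otimes>\<^bsub>G\<^esub> t = (inv\<^bsub>G\<^esub> g \<otimes>\<^bsub>G\<^esub> w) \<otimes>\<^bsub>G\<^esub> (inv\<^bsub>G\<^esub> w \<otimes>\<^bsub>G\<^esub> t)"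
          using g c by (simp add: m_assoc)
        moreover have "inv\<^bsub>G\<^esub> w \<otimes>\<^bsub>G\<^esub> t \<in> \<Delta>"
          using w(1) t unfolding \<Delta>_def by force
        ultimately have "inv\<^bsub>G\<^esub> g \<otimes>\<^bsub>G\<^esub> t \<in> E <#>\<^bsub>G\<^esub> \<Delta>"
          using w(2) unfolding set_mult_def by blast
        then have "?z (inv\<^bsub>G\<^esub> g \<otimes>\<^bsub>G\<^esub> t) = x (inv\<^bsub>G\<^esub> g \<otimes>\<^bsub>G\<^esub> t)"
          using eq by simp
        then show ?thesis
          using c by (simp only: shift_def restrict_apply)
      qed
      then have "restrict (shift G g ?z) \<Omega> = restrict (shift G g x) \<Omega>"
        by (rule restrict_ext)
      then show ?thesis using xP[OF g] by (simp only:)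
    next
      case False
      have "shift G g ?z t = shift G g y t" if "t \<in> \<Omega>" for t
      proof -
        have "inv\<^bsub>G\<^esub> g \<otimes>\<^bsub>G\<^esub> t \<notin> E" using False that by blast
        then show ?thesis by (simp only: shift_def restrict_apply if_False)
      qed
      then have "restrict (shift G g ?z) \<Omega> = restrict (shift G g y) \<Omega>"
        by (rule restrict_ext)
      then show ?thesis using yP[OF g] by (simp only:)
    qed
    ultimately show ?thesis by (subst X) blast
  qed
  show ?thesis
    unfolding splicable_def by (intro exI[of _ \<Delta>] conjI allI impI \<Delta>) (elim conjE, rule splice)
qed


section \<open>Sofic approximations\<close>

definition hamming :: "nat \<Rightarrow> (nat \<Rightarrow> nat) \<Rightarrow> (nat \<Rightarrow> nat) \<Rightarrow> real" where
  "hamming d p q = real (card {a \<in> {1..d}. p a \<noteq> q a}) / real d"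

definition sofic_approximation ::
    "('g, 'm) monoid_scheme \<Rightarrow> (nat \<Rightarrow> nat) \<Rightarrow> (nat \<Rightarrow> 'g \<Rightarrow> nat \<Rightarrow> nat) \<Rightarrow> bool" where
  "sofic_approximation G d \<sigma> \<longleftrightarrow>
     (\<forall>j. 0 < d j) \<and>
     (\<forall>j. \<forall>s\<in>carrier G. \<sigma> j s permutes {1..d j}) \<and>
     filterlim d at_top sequentially \<and>
     (\<forall>s\<in>carrier G. \<forall>t\<in>carrier G.
        (\<lambda>j. hamming (d j) (\<sigma> j s \<circ> \<sigma> j t) (\<sigma> j (s \<otimes>\<^bsub>G\<^esub> t))) \<longlonglongrightarrow> 0) \<and>
     (\<forall>s\<in>carrier G. \<forall>t\<in>carrier G. s \<noteq> t \<longrightarrow>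
        (\<lambda>j. hamming (d j) (\<sigma> j s) (\<sigma> j t)) \<longlonglongrightarrow> 1)"

definition sofic_group :: "('g, 'm) monoid_scheme \<Rightarrow> bool" where
  "sofic_group G \<longleftrightarrow> (\<exists>d \<sigma>. sofic_approximation G d \<sigma>)"


section \<open>Sofic topological entropy\<close>

definition compatible_metric ::
    "('g, 'm) monoid_scheme \<Rightarrow> 'a set \<Rightarrow> ('g \<Rightarrow> 'a) set \<Rightarrow> (('g \<Rightarrow> 'a) \<Rightarrow> ('g \<Rightarrow> 'a) \<Rightarrow> real) \<Rightarrow> bool" where
  "compatible_metric G A X \<rho> \<longleftrightarrow>
     Metric_space X \<rho> \<and> Metric_space.mtopology X \<rho> = subtopology (full_shift G A) X"

definition rho_2 :: "('x \<Rightarrow> 'x \<Rightarrow> real) \<Rightarrow> nat \<Rightarrow> (nat \<Rightarrow> 'x) \<Rightarrow> (nat \<Rightarrow> 'x) \<Rightarrow> real" where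
  "rho_2 \<rho> d \<phi> \<psi> = sqrt ((\<Sum>a\<in>{1..d}. (\<rho> (\<phi> a) (\<psi> a))\<^sup>2) / real d)"

definition rho_inf :: "('x \<Rightarrow> 'x \<Rightarrow> real) \<Rightarrow> nat \<Rightarrow> (nat \<Rightarrow> 'x) \<Rightarrow> (nat \<Rightarrow> 'x) \<Rightarrow> real" where
  "rho_inf \<rho> d \<phi> \<psi> = Max ((\<lambda>a. \<rho> (\<phi> a) (\<psi> a)) ` {1..d})"

definition Map_set ::
    "('g, 'm) monoid_scheme \<Rightarrow> ('g \<Rightarrow> 'a) set \<Rightarrow> (('g \<Rightarrow> 'a) \<Rightarrow> ('g \<Rightarrow> 'a) \<Rightarrow> real) \<Rightarrow>
     'g set \<Rightarrow> real \<Rightarrow> nat \<Rightarrow> ('g \<Rightarrow> nat \<Rightarrow> nat) \<Rightarrow> (nat \<Rightarrow> 'g \<Rightarrow> 'a) set" where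
  "Map_set G X \<rho> F \<delta> d \<sigma> =
     {\<phi> \<in> {1..d} \<rightarrow>\<^sub>E X. \<forall>s\<in>F. rho_2 \<rho> d (\<phi> \<circ> \<sigma> s) (\<lambda>a. shift G s (\<phi> a)) < \<delta>}"

text \<open>
  An infinite separated subset yields the value \<open>\<infinity>\<close>, through its finite subsets.
\<close>

definition sep_number ::
    "('x \<Rightarrow> 'x \<Rightarrow> real) \<Rightarrow> nat \<Rightarrow> real \<Rightarrow> (nat \<Rightarrow> 'x) set \<Rightarrow> enat" where
  "sep_number \<rho> d \<epsilon> M =
     Sup {enat (card S) | S. S \<subseteq> M \<and> finite S \<and> pairwise (\<lambda>\<phi> \<psi>. \<epsilon> \<le> rho_inf \<rho> d \<phi> \<psi>) S}"

definition log_enat :: "enat \<Rightarrow> ereal" where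
  "log_enat N =
     (case N of enat n \<Rightarrow> (if n = 0 then - \<infinity> else ereal (ln (real n))) | \<infinity> \<Rightarrow> \<infinity>)"

definition sofic_entropy ::
    "('g, 'm) monoid_scheme \<Rightarrow> ('g \<Rightarrow> 'a) set \<Rightarrow> (('g \<Rightarrow> 'a) \<Rightarrow> ('g \<Rightarrow> 'a) \<Rightarrow> real) \<Rightarrow>
     (nat \<Rightarrow> nat) \<Rightarrow> (nat \<Rightarrow> 'g \<Rightarrow> nat \<Rightarrow> nat) \<Rightarrow> ereal" where
  "sofic_entropy G X \<rho> d \<sigma> =
     (SUP \<epsilon>\<in>{0<..}. INF F\<in>{F. finite F \<and> F \<noteq> {} \<and> F \<subseteq> carrier G}. INF \<delta>\<in>{0<..}.
        limsup (\<lambda>j. ereal (1 / real (d j)) *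
          log_enat (sep_number \<rho> (d j) \<epsilon> (Map_set G X \<rho> F \<delta> (d j) (\<sigma> j)))))"

end

theory Submission
  imports Defs
begin

text \<open>
Suppose that \<open>f\<close> is injective, continuous and equivariant on \<open>X\<close> but misses a point \<open>p\<close> of \<open>X\<close>. Then \<open>f ` X\<close> is a
copy of \<open>X\<close>, so it ought to have the same entropy as \<open>X\<close>; on the other hand it misses a finite pattern of \<open>p\<close>, and
strong irreducibility leaves so much freedom to plant this pattern that the entropy of \<open>f ` X\<close> has to be
strictly smaller. As the entropy of a subshift is finite, and nonnegative by assumption, this is absurd.

Entropy is handled through its finitary counterpart, the number of microstates: colourings \<open>c\<close> of the
sites \<open>{1..d j}\<close> such that, at all but \<open>\<eta> * d j\<close> sites \<open>a\<close>, the pattern that \<open>c\<close> shows along the approximate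
orbit of \<open>a\<close> extends on a finite window \<open>W\<close> to a point of \<open>X\<close>. Four facts are combined.

\<^item> The local rule of \<open>f\<close> maps microstates of \<open>X\<close> to microstates of \<open>f ` X\<close>, and since the inverse of \<open>f\<close> is given by a local
  rule as well, the fibres have at most \<open>exp (\<kappa> * d j)\<close> elements, with \<open>\<kappa> > 0\<close> as small as desired (\<open>block_map_microstates_growth\<close>).

\<^item> Choose a set of sites of positive density whose neighbourhoods are disjoint. At each of them the missing pattern can be planted or not,
  independently. Strong irreducibility connects the pattern to its surroundings,
  and splicability ensures that the result is a microstate of \<open>X\<close> for arbitrarily large windows.
  A weighted count shows that \<open>X\<close> has at least \<open>exp (c * d j)\<close> times as
  many microstates as \<open>f ` X\<close>, with \<open>c > 0\<close> independent of the window (\<open>missing_pattern_entropy_gap\<close>).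

\<^item> By the first two facts, refining the window and the tolerance divides the number of microstates of \<open>X\<close> by
  \<open>exp (c / 2 * d j)\<close>. Repeating this often enough leaves none at all for large \<open>j\<close> (\<open>microstates_vanish\<close>).

\<^item> Nonnegative entropy means that microstates exist for infinitely many \<open>j\<close>, whatever the window and the
  tolerance (\<open>microstates_frequently_nonempty\<close>).
\<close>

section \<open>Counting\<close>

lemma sum_Pow_power_card:
  fixes t :: real
  assumes "finite I"
  shows "(\<Sum>S\<in>Pow I. t ^ card S) = (1 + t) ^ card I"
proof -
  have "(1 + t) ^ card I = (\<Prod>i\<in>I. t + 1)" by (simp add: add.commute)
  also have "\<dots> = (\<Sum>S\<in>Pow I. (\<Prod>i\<in>S. t) * (\<Prod>i\<in>I - S. 1))"
    by (rule prod_add[OF assms])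
  finally show ?thesis by simp
qed

text \<open>
A Chernoff bound: for \<open>t \<le> 1\<close> the factor \<open>t ^ m\<close> is at most \<open>t ^ card S\<close>
whenever \<open>card S \<le> m\<close>, and then the sum may be extended to all subsets.
\<close>

lemma small_subsets_weight_le:
  fixes q t :: real
  assumes "finite I" "0 \<le> q" "0 < t" "t \<le> 1"
  shows "t ^ m * (\<Sum>S | S \<subseteq> I \<and> card S \<le> m. q ^ card S) \<le> (1 + t * q) ^ card I"
proof -
  have "t ^ m * (\<Sum>S | S \<subseteq> I \<and> card S \<le> m. q ^ card S)
      = (\<Sum>S | S \<subseteq> I \<and> card S \<le> m. t ^ m * q ^ card S)"
    by (rule sum_distrib_left)
  also have "\<dots> \<le> (\<Sum>S | S \<subseteq> I \<and> card S \<le> m. (t * q) ^ card S)"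
    using assms by (intro sum_mono) (simp add: power_mult_distrib mult_right_mono power_decreasing)
  also have "\<dots> \<le> (\<Sum>S\<in>Pow I. (t * q) ^ card S)"
    using assms by (intro sum_mono2) auto
  also have "\<dots> = (1 + t * q) ^ card I"
    by (rule sum_Pow_power_card[OF assms(1)])
  finally show ?thesis .
qed

text \<open>
In the preceding bound, \<open>t\<close> is taken so small that \<open>(1 + t * q) ^ n\<close> costs at most half of the
exponential budget, and then \<open>\<eta>\<close> so small that dividing by \<open>t ^ m\<close> costs at most the other half.
It bounds both Hamming balls of small radius and the number of ways to
choose a small set of exceptional sites.
\<close>

lemma small_subsets_weight_subexponential:
  fixes q \<kappa> :: real
  assumes q: "1 \<le> q" and \<kappa>: "0 < \<kappa>"
  obtains \<eta> where "0 < \<eta>"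
    "\<And>(I::'b set) m. finite I \<Longrightarrow> real m \<le> \<eta> * real (card I) \<Longrightarrow>
       (\<Sum>S | S \<subseteq> I \<and> card S \<le> m. q ^ card S) \<le> exp (\<kappa> * real (card I))"
proof -
  define t where "t = min 1 (\<kappa> / (2 * q))"
  have t: "0 < t" "t \<le> 1" and tq: "t * q \<le> \<kappa> / 2"
    using assms by (auto simp: t_def min_def field_simps split: if_splits)
  \<comment> \<open>The summand 1 keeps the denominator positive when \<open>t = 1\<close>.\<close>
  define \<eta> where "\<eta> = \<kappa> / (2 * (1 - ln t))"
  have lt: "ln t \<le> 0" using t by simp
  have \<eta>: "0 < \<eta>" using \<kappa> lt unfolding \<eta>_def by (intro divide_pos_pos) auto
  have \<eta>_ln: "\<eta> * (- ln t) \<le> \<kappa> / 2"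
  proof -
    have "\<eta> * (- ln t) \<le> \<eta> * (1 - ln t)" using \<eta> by (intro mult_left_mono) auto
    also have "\<dots> = \<kappa> / 2" using lt unfolding \<eta>_def by (simp add: field_simps)
    finally show ?thesis .
  qed
  show ?thesis
  proof (rule that[OF \<eta>])
    fix I :: "'b set" and m
    assume I: "finite I" and m: "real m \<le> \<eta> * real (card I)"
    let ?s = "\<Sum>S | S \<subseteq> I \<and> card S \<le> m. q ^ card S"
    have e: "exp (real m * ln t) = t ^ m" using t by (simp add: exp_of_nat_mult)
    have "?s = exp (- (real m * ln t)) * (t ^ m * ?s)"
      using t by (simp add: exp_minus e)
    also have "\<dots> \<le> exp (- (real m * ln t)) * (1 + t * q) ^ card I"
      using small_subsets_weight_le[OF I _ t, of q m] q by (intro mult_left_mono) auto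
    also have "\<dots> \<le> exp (- (real m * ln t)) * exp (\<kappa> / 2 * real (card I))"
    proof (intro mult_left_mono)
      have "1 + t * q \<le> exp (\<kappa> / 2)"
        using tq exp_ge_add_one_self[of "\<kappa> / 2"] by linarith
      then have "(1 + t * q) ^ card I \<le> exp (\<kappa> / 2) ^ card I"
        using t q by (intro power_mono) auto
      then show "(1 + t * q) ^ card I \<le> exp (\<kappa> / 2 * real (card I))"
        by (simp add: exp_of_nat_mult[symmetric] mult.commute)
    qed simp
    also have "\<dots> = exp (real m * (- ln t) + \<kappa> / 2 * real (card I))"
      by (simp add: exp_add[symmetric] algebra_simps)
    also have "\<dots> \<le> exp (\<kappa> * real (card I))"
    proof -
      have "real m * (- ln t) \<le> \<eta> * real (card I) * (- ln t)"
        using m lt by (intro mult_right_mono) auto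
      also have "\<dots> = \<eta> * (- ln t) * real (card I)" by simp
      also have "\<dots> \<le> \<kappa> / 2 * real (card I)"
        using \<eta>_ln by (intro mult_right_mono) auto
      finally show ?thesis by simp
    qed
    finally show "?s \<le> exp (\<kappa> * real (card I))" .
  qed
qed

lemma card_agree_off_le:
  assumes A: "finite A" and U: "finite U"
  shows "finite {c \<in> I \<rightarrow>\<^sub>E A. \<forall>a. a \<notin> U \<longrightarrow> c a = c0 a}"
    and "card {c \<in> I \<rightarrow>\<^sub>E A. \<forall>a. a \<notin> U \<longrightarrow> c a = c0 a} \<le> card A ^ card (U \<inter> I)"
proof -
  let ?C = "{c \<in> I \<rightarrow>\<^sub>E A. \<forall>a. a \<notin> U \<longrightarrow> c a = c0 a}"
  let ?r = "\<lambda>c. restrict c (U \<inter> I)"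
  have inj: "inj_on ?r ?C"
  proof (rule inj_onI, rule ext)
    fix c c' a assume c: "c \<in> ?C" "c' \<in> ?C" and eq: "?r c = ?r c'"
    show "c a = c' a"
    proof (cases "a \<in> U \<inter> I")
      case True
      then show ?thesis using fun_cong[OF eq, of a] by simp
    next
      case False
      then show ?thesis using c by (auto simp: PiE_iff extensional_def)
    qed
  qed
  have img: "?r ` ?C \<subseteq> (U \<inter> I) \<rightarrow>\<^sub>E A" by (auto simp: PiE_iff extensional_def split: if_splits)
  have fin: "finite ((U \<inter> I) \<rightarrow>\<^sub>E A)" using A U by (intro finite_PiE) auto
  show "finite ?C" using inj_on_finite[OF inj img fin] .
  show "card ?C \<le> card A ^ card (U \<inter> I)"
    using card_inj_on_le[OF inj img fin] U by (simp add: card_PiE)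
qed

text \<open>
A colouring is recovered from the set of places where it departs from the centre and from its values there.
\<close>

lemma hamming_ball_card_le:
  assumes A: "finite A" and I: "finite I"
  shows "real (card {c \<in> I \<rightarrow>\<^sub>E A. card {a \<in> I. c a \<noteq> c0 a} \<le> m})
      \<le> (\<Sum>S | S \<subseteq> I \<and> card S \<le> m. real (card A) ^ card S)"
proof (cases "\<exists>c1. c1 \<in> I \<rightarrow>\<^sub>E A")
  case False
  then have "{c \<in> I \<rightarrow>\<^sub>E A. card {a \<in> I. c a \<noteq> c0 a} \<le> m} = {}" by blast
  then show ?thesis by (simp only: card.empty of_nat_0) (intro sum_nonneg, simp)
next
  case True
  define c2 where "c2 = restrict c0 I"
  have fin: "finite {S. S \<subseteq> I \<and> card S \<le> m}" using I by simp
  have "{c \<in> I \<rightarrow>\<^sub>E A. card {a \<in> I. c a \<noteq> c0 a} \<le> m}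
      \<subseteq> (\<Union>S\<in>{S. S \<subseteq> I \<and> card S \<le> m}. {c \<in> I \<rightarrow>\<^sub>E A. \<forall>a. a \<notin> S \<longrightarrow> c a = c2 a})"
    (is "?L \<subseteq> _")
  proof
    fix c assume c: "c \<in> ?L"
    let ?S = "{a \<in> I. c a \<noteq> c0 a}"
    have "?S \<in> {S. S \<subseteq> I \<and> card S \<le> m}" using c by blast
    moreover have "c a = c2 a" if "a \<notin> ?S" for a
      using that c by (auto simp: c2_def PiE_iff extensional_def)
    ultimately show "c \<in> (\<Union>S\<in>{S. S \<subseteq> I \<and> card S \<le> m}.
        {c \<in> I \<rightarrow>\<^sub>E A. \<forall>a. a \<notin> S \<longrightarrow> c a = c2 a})" using c by blast
  qed
  then have "card ?L \<le> card (\<Union>S\<in>{S. S \<subseteq> I \<and> card S \<le> m}.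
        {c \<in> I \<rightarrow>\<^sub>E A. \<forall>a. a \<notin> S \<longrightarrow> c a = c2 a})"
    using fin A I by (intro card_mono finite_UN_I card_agree_off_le) (auto intro: finite_subset)
  also have "\<dots> \<le> (\<Sum>S | S \<subseteq> I \<and> card S \<le> m.
        card {c \<in> I \<rightarrow>\<^sub>E A. \<forall>a. a \<notin> S \<longrightarrow> c a = c2 a})"
    by (rule card_UN_le[OF fin])
  also have "\<dots> \<le> (\<Sum>S | S \<subseteq> I \<and> card S \<le> m. card A ^ card S)"
  proof (rule sum_mono)
    fix S assume S: "S \<in> {S. S \<subseteq> I \<and> card S \<le> m}"
    then have "finite S" "S \<inter> I = S" using I by (auto intro: finite_subset)
    then show "card {c \<in> I \<rightarrow>\<^sub>E A. \<forall>a. a \<notin> S \<longrightarrow> c a = c2 a} \<le> card A ^ card S"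
      using card_agree_off_le(2)[OF A, of S I c2] by simp
  qed
  finally have "real (card ?L) \<le> real (\<Sum>S | S \<subseteq> I \<and> card S \<le> m. card A ^ card S)"
    by (rule of_nat_mono)
  then show ?thesis by simp
qed

lemma card_le_fibres:
  assumes "finite S" "finite R" "f ` S \<subseteq> R" "\<And>r. r \<in> R \<Longrightarrow> real (card {x \<in> S. f x = r}) \<le> k"
  shows "real (card S) \<le> k * real (card R)"
proof -
  have "real (card S) = (\<Sum>r\<in>R. \<Sum>x | x \<in> S \<and> f x = r. 1)"
    using sum.group[OF assms(1-3), of "\<lambda>_. 1::real"] by simp
  also have "\<dots> \<le> (\<Sum>r\<in>R. k)" using assms(4) by (intro sum_mono) simp
  finally show ?thesis by (simp add: mult.commute)
qed

text \<open>
An independent set of maximal size conflicts with every point of \<open>R\<close>, so the conflict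
neighbourhoods of its points, of size at most \<open>k\<close> each, cover \<open>R\<close>.
\<close>

lemma exists_large_independent_set:
  assumes R: "finite R"
    and refl: "\<And>a. a \<in> R \<Longrightarrow> conflict a a"
    and sym: "\<And>a b. conflict a b \<Longrightarrow> conflict b a"
    and deg: "\<And>a. a \<in> R \<Longrightarrow> card {b \<in> R. conflict a b} \<le> k"
  obtains T where "T \<subseteq> R" "pairwise (\<lambda>a b. \<not> conflict a b) T" "card R \<le> k * card T"
proof -
  let ?P = "\<lambda>T. T \<subseteq> R \<and> pairwise (\<lambda>a b. \<not> conflict a b) T"
  have "?P {}" by simp
  moreover have "\<forall>T. ?P T \<longrightarrow> card T < Suc (card R)"
    using R by (auto simp: less_Suc_eq_le intro: card_mono)
  ultimately have "\<exists>T. ?P T \<and> (\<forall>T'. ?P T' \<longrightarrow> card T' \<le> card T)"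
    by (rule ex_has_greatest_nat)
  then obtain T where T: "?P T" and max: "\<And>T'. ?P T' \<Longrightarrow> card T' \<le> card T"
    by blast
  have finT: "finite T" using T R finite_subset by blast
  have "R \<subseteq> (\<Union>a\<in>T. {b \<in> R. conflict a b})"
  proof
    fix b assume b: "b \<in> R"
    show "b \<in> (\<Union>a\<in>T. {b \<in> R. conflict a b})"
    proof (rule ccontr)
      assume n: "b \<notin> (\<Union>a\<in>T. {b \<in> R. conflict a b})"
      then have "b \<notin> T" using refl b by blast
      moreover have "?P (insert b T)" using n b T sym by (auto simp: pairwise_insert)
      ultimately show False using max[of "insert b T"] finT by simp
    qed
  qed
  then have "card R \<le> card (\<Union>a\<in>T. {b \<in> R. conflict a b})"
    using finT R by (intro card_mono) auto
  also have "\<dots> \<le> (\<Sum>a\<in>T. card {b \<in> R. conflict a b})" by (rule card_UN_le[OF finT])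
  also have "\<dots> \<le> (\<Sum>a\<in>T. k)" using T deg by (intro sum_mono) auto
  finally have "card R \<le> k * card T" by (simp add: mult.commute)
  then show ?thesis using T that by blast
qed

text \<open>
Each \<open>c\<close> in \<open>C\<close> may be marked at any set \<open>S\<close> of sites from \<open>G c\<close>, at the price of
forgetting \<open>c\<close> on the blocks \<open>U a\<close> with \<open>a \<in> S\<close>. Give the pair \<open>(c, S)\<close> the weight \<open>t ^ card S\<close>
with \<open>t = 1 / card A ^ k\<close>. The weights of the pairs over one \<open>c\<close> add up to
\<open>(1 + t) ^ card (G c)\<close>, which is where the exponential gain comes from.
In the other direction, a result \<open>c'\<close> shows the set \<open>P\<close> of its marked sites in \<open>T\<close>, and \<open>S\<close> is \<open>P\<close> without at
most \<open>m\<close> sites that carried the mark from the start. Given \<open>S\<close>, the number of possible \<open>c\<close> is at most the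
number of fillings of the blocks, which the weight cancels exactly. Weighting makes it
unnecessary to fix the density of \<open>S\<close> in advance.
\<close>

lemma marking_count:
  fixes Phi :: "('b \<Rightarrow> 'a) \<Rightarrow> 'b set \<Rightarrow> 'b \<Rightarrow> 'a"
  assumes A: "finite A" "A \<noteq> {}" and I: "finite I" and T: "finite T"
    and C: "C \<subseteq> I \<rightarrow>\<^sub>E A" and C': "C' \<subseteq> I \<rightarrow>\<^sub>E A"
    and G: "\<And>c. c \<in> C \<Longrightarrow> G c \<subseteq> T" "\<And>c. c \<in> C \<Longrightarrow> card (T - G c) \<le> m"
    and U: "\<And>a. a \<in> T \<Longrightarrow> finite (U a)" "\<And>a. a \<in> T \<Longrightarrow> card (U a) \<le> k"
    and Phi: "\<And>c S. c \<in> C \<Longrightarrow> S \<subseteq> G c \<Longrightarrow> Phi c S \<in> C'"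
    and off: "\<And>c S a. c \<in> C \<Longrightarrow> S \<subseteq> G c \<Longrightarrow> a \<notin> (\<Union>b\<in>S. U b) \<Longrightarrow> Phi c S a = c a"
    and mark: "\<And>c S a. c \<in> C \<Longrightarrow> S \<subseteq> G c \<Longrightarrow> a \<in> G c \<Longrightarrow> marked (Phi c S) a \<longleftrightarrow> a \<in> S"
  shows "real (card C) * (1 + 1 / real (card A) ^ k) ^ (card T - m)
      \<le> real (card {B. B \<subseteq> T \<and> card B \<le> m}) * real (card C')"
proof -
  define t where "t = 1 / real (card A) ^ k"
  have q: "1 \<le> card A" using A by (simp add: Suc_leI card_gt_0_iff)
  then have t: "0 < t" by (simp add: t_def)
  have finPi: "finite (I \<rightarrow>\<^sub>E A)" using A I by (intro finite_PiE) auto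
  have finC: "finite C" "finite C'" using finite_subset[OF C finPi] finite_subset[OF C' finPi] by auto
  have finG: "finite (G c)" if "c \<in> C" for c using G(1)[OF that] T finite_subset by blast
  define Q where "Q = Sigma C (\<lambda>c. Pow (G c))"
  have finQ: "finite Q" using finC finG unfolding Q_def by (intro finite_SigmaI) auto
  have "real (card C) * (1 + t) ^ (card T - m) \<le> (\<Sum>c\<in>C. (1 + t) ^ card (G c))"
  proof -
    have "(\<Sum>c\<in>C. (1 + t) ^ (card T - m)) \<le> (\<Sum>c\<in>C. (1 + t) ^ card (G c))"
    proof (intro sum_mono power_increasing)
      fix c assume c: "c \<in> C"
      have "card T = card (G c) + card (T - G c)"
        using G(1)[OF c] T by (metis card_Diff_subset card_mono finite_subset le_add_diff_inverse)
      then show "card T - m \<le> card (G c)" using G(2)[OF c] by simp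
    qed (use t in simp)
    then show ?thesis by simp
  qed
  also have "\<dots> = (\<Sum>(c, S)\<in>Q. t ^ card S)"
    using finC finG by (simp add: Q_def sum.Sigma[symmetric] sum_Pow_power_card)
  also have "\<dots> = (\<Sum>c'\<in>C'. \<Sum>(c, S) | (c, S) \<in> Q \<and> Phi c S = c'. t ^ card S)"
  proof -
    have "(\<lambda>(c, S). Phi c S) ` Q \<subseteq> C'" using Phi by (auto simp: Q_def)
    from sum.group[OF finQ finC(2) this, of "\<lambda>(c, S). t ^ card S"]
    show ?thesis by (simp add: case_prod_unfold)
  qed
  also have "\<dots> \<le> (\<Sum>c'\<in>C'. real (card {B. B \<subseteq> T \<and> card B \<le> m}))"
  proof (rule sum_mono)
    fix c' assume c': "c' \<in> C'"
    \<comment> \<open>\<open>\<S>\<close> contains every set that can lead to \<open>c'\<close>, and \<open>K S\<close> every colouring that \<open>S\<close> can turn into \<open>c'\<close>.\<close>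
    define P where "P = {a \<in> T. marked c' a}"
    define \<S> where "\<S> = {S. S \<subseteq> P \<and> card (P - S) \<le> m}"
    define V where "V S = (\<Union>b\<in>S. U b)" for S
    define K where "K S = {c \<in> I \<rightarrow>\<^sub>E A. \<forall>a. a \<notin> V S \<longrightarrow> c a = c' a}" for S
    have P: "P \<subseteq> T" "finite P" using T by (auto simp: P_def)
    have fin\<S>: "finite \<S>" using P by (simp add: \<S>_def)
    have finV: "finite (V S)" and cardV: "card (V S) \<le> k * card S" if "S \<in> \<S>" for S
    proof -
      have S: "S \<subseteq> T" "finite S" using that P finite_subset by (auto simp: \<S>_def)
      show "finite (V S)" using S U(1) by (auto simp: V_def)
      have "card (V S) \<le> (\<Sum>b\<in>S. card (U b))" unfolding V_def by (rule card_UN_le[OF S(2)])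
      also have "\<dots> \<le> (\<Sum>b\<in>S. k)" using S U(2) by (intro sum_mono) auto
      finally show "card (V S) \<le> k * card S" by (simp add: mult.commute)
    qed
    have sub: "{(c, S). (c, S) \<in> Q \<and> Phi c S = c'} \<subseteq> (\<lambda>(S, c). (c, S)) ` Sigma \<S> K"
    proof clarify
      fix c S assume *: "(c, S) \<in> Q" "c' = Phi c S"
      then have c: "c \<in> C" "S \<subseteq> G c" by (auto simp: Q_def)
      have "S \<subseteq> P" using mark[OF c] c G(1)[OF c(1)] *(2) by (auto simp: P_def)
      moreover have "P - S \<subseteq> T - G c" using mark[OF c] *(2) by (auto simp: P_def)
      then have "card (P - S) \<le> m"
        using card_mono[of "T - G c" "P - S"] T G(2)[OF c(1)] by simp
      ultimately have "S \<in> \<S>" by (simp add: \<S>_def)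
      moreover have "c \<in> K S" using C c off[OF c] *(2) by (auto simp: K_def V_def)
      ultimately show "(c, S) \<in> (\<lambda>(S, c). (c, S)) ` Sigma \<S> K" by force
    qed
    have finK: "finite (K S)" and cardK: "real (card (K S)) * t ^ card S \<le> 1" if S: "S \<in> \<S>" for S
    proof -
      show "finite (K S)" unfolding K_def using A finV[OF S] by (intro card_agree_off_le)
      have "card (K S) \<le> card A ^ card (V S \<inter> I)"
        unfolding K_def using A finV[OF S] by (intro card_agree_off_le)
      also have "\<dots> \<le> card A ^ (k * card S)"
        using q cardV[OF S] card_mono[of "V S" "V S \<inter> I"] finV[OF S]
        by (intro power_increasing) auto
      finally have "real (card (K S)) \<le> real (card A) ^ (k * card S)"
        by (metis of_nat_le_iff of_nat_power)
      then have "real (card (K S)) * t ^ card S \<le> real (card A) ^ (k * card S) * t ^ card S"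
        using t by (intro mult_right_mono) auto
      also have "\<dots> = 1" using q by (simp add: t_def power_mult power_divide)
      finally show "real (card (K S)) * t ^ card S \<le> 1" .
    qed
    have "(\<Sum>(c, S) | (c, S) \<in> Q \<and> Phi c S = c'. t ^ card S)
        \<le> (\<Sum>(c, S)\<in>(\<lambda>(S, c). (c, S)) ` Sigma \<S> K. t ^ card S)"
      using sub t finK fin\<S> by (intro sum_mono2) auto
    also have "\<dots> = (\<Sum>(S, c)\<in>Sigma \<S> K. t ^ card S)"
      by (subst sum.reindex) (auto simp: inj_on_def case_prod_unfold)
    also have "\<dots> = (\<Sum>S\<in>\<S>. real (card (K S)) * t ^ card S)"
      using fin\<S> finK by (simp add: sum.Sigma[symmetric])
    also have "\<dots> \<le> real (card \<S>)"
      using cardK sum_mono[of \<S> "\<lambda>S. real (card (K S)) * t ^ card S" "\<lambda>_. 1"] by simp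
    also have "\<dots> \<le> real (card {B. B \<subseteq> T \<and> card B \<le> m})"
    proof -
      have "inj_on (\<lambda>S. P - S) \<S>" by (auto simp: inj_on_def \<S>_def)
      moreover have "(\<lambda>S. P - S) ` \<S> \<subseteq> {B. B \<subseteq> T \<and> card B \<le> m}"
        using P by (auto simp: \<S>_def)
      ultimately show ?thesis using T by (intro of_nat_mono card_inj_on_le) auto
    qed
    finally show "(\<Sum>(c, S) | (c, S) \<in> Q \<and> Phi c S = c'. t ^ card S)
        \<le> real (card {B. B \<subseteq> T \<and> card B \<le> m})" .
  qed
  finally show ?thesis by (simp add: t_def mult.commute)
qed

section \<open>Microstates\<close>

text \<open>
In the applications \<open>\<tau> h\<close> is the permutation that the sofic approximation assigns to the inverse of \<open>h\<close>.
For a true action, and \<open>c\<close> the symbols at the identity of an equivariant map \<open>\<phi>\<close> into \<open>X\<close>, the name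
\<open>\<lambda>h. c (\<tau> h a)\<close> of the site \<open>a\<close> is the point \<open>\<phi> a\<close> itself. Admissibility asks for this only on a window.
\<close>

definition admissible_at :: "('g \<Rightarrow> 'b \<Rightarrow> 'b) \<Rightarrow> ('g \<Rightarrow> 'a) set \<Rightarrow> 'g set \<Rightarrow> ('b \<Rightarrow> 'a) \<Rightarrow> 'b \<Rightarrow> bool" where
  "admissible_at \<tau> X W c a \<longleftrightarrow> (\<exists>x\<in>X. \<forall>h\<in>W. c (\<tau> h a) = x h)"

definition microstates ::
    "('g \<Rightarrow> 'b \<Rightarrow> 'b) \<Rightarrow> 'b set \<Rightarrow> 'a set \<Rightarrow> ('g \<Rightarrow> 'a) set \<Rightarrow> 'g set \<Rightarrow> real \<Rightarrow> ('b \<Rightarrow> 'a) set" where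
  "microstates \<tau> I A X W \<eta> =
     {c \<in> I \<rightarrow>\<^sub>E A. real (card {a \<in> I. \<not> admissible_at \<tau> X W c a}) \<le> \<eta> * real (card I)}"

text \<open>
Near a regular site \<open>\<tau>\<close> looks like a free right action, so that the name of the site
\<open>\<tau> g a\<close> is the name of \<open>a\<close> translated by \<open>g\<close>.
\<close>

definition regular_at :: "('g, 'm) monoid_scheme \<Rightarrow> ('g \<Rightarrow> 'b \<Rightarrow> 'b) \<Rightarrow> 'g set \<Rightarrow> 'b \<Rightarrow> bool" where
  "regular_at G \<tau> Q a \<longleftrightarrow>
     (\<forall>s\<in>Q. \<forall>t\<in>Q. \<tau> (s \<otimes>\<^bsub>G\<^esub> t) a = \<tau> t (\<tau> s a)) \<and> inj_on (\<lambda>s. \<tau> s a) Q"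

lemma admissible_at_mono:
  "admissible_at \<tau> X W c a \<Longrightarrow> W' \<subseteq> W \<Longrightarrow> X \<subseteq> X' \<Longrightarrow> admissible_at \<tau> X' W' c a"
  unfolding admissible_at_def by blast

lemma finite_microstates:
  "finite I \<Longrightarrow> finite A \<Longrightarrow> finite (microstates \<tau> I A X W \<eta>)"
  unfolding microstates_def by (rule finite_subset[of _ "I \<rightarrow>\<^sub>E A"]) (auto intro: finite_PiE)

text \<open>
A local modification of \<open>c\<close> can spoil admissibility only at sites that were bad for \<open>c\<close> or are irregular.
\<close>

lemma microstatesI:
  assumes I: "finite I" and c: "c \<in> microstates \<tau> I A Y W' \<eta>'" and c': "c' \<in> I \<rightarrow>\<^sub>E A"
    and irr: "real (card {a \<in> I. \<not> R a}) \<le> \<zeta> * real (card I)" and le: "\<eta>' + \<zeta> \<le> \<eta>"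
    and adm: "\<And>a. a \<in> I \<Longrightarrow> R a \<Longrightarrow> admissible_at \<tau> Y W' c a \<Longrightarrow> admissible_at \<tau> X W c' a"
  shows "c' \<in> microstates \<tau> I A X W \<eta>"
proof -
  have "card {a \<in> I. \<not> admissible_at \<tau> X W c' a}
      \<le> card ({a \<in> I. \<not> admissible_at \<tau> Y W' c a} \<union> {a \<in> I. \<not> R a})"
    using I adm by (intro card_mono) auto
  also have "\<dots> \<le> card {a \<in> I. \<not> admissible_at \<tau> Y W' c a} + card {a \<in> I. \<not> R a}"
    by (rule card_Un_le)
  finally have "real (card {a \<in> I. \<not> admissible_at \<tau> X W c' a})
      \<le> \<eta>' * real (card I) + \<zeta> * real (card I)"
    using c irr by (simp add: microstates_def)
  also have "\<dots> \<le> \<eta> * real (card I)"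
    using le by (simp add: distrib_right[symmetric] mult_right_mono)
  finally show ?thesis using c' by (simp add: microstates_def)
qed

locale shift_invariant = group G for G :: "('g, 'm) monoid_scheme" (structure) +
  fixes A :: "'a set" and X :: "('g \<Rightarrow> 'a) set"
  assumes finite_A: "finite A"
    and X_sub: "X \<subseteq> carrier G \<rightarrow>\<^sub>E A"
    and shift_closed: "\<And>g x. g \<in> carrier G \<Longrightarrow> x \<in> X \<Longrightarrow> shift G g x \<in> X"
begin

lemma X_value: "x \<in> X \<Longrightarrow> h \<in> carrier G \<Longrightarrow> x h \<in> A"
  using X_sub by (auto simp: PiE_iff)

lemma shift_inv_apply:
  "k \<in> carrier G \<Longrightarrow> h \<in> carrier G \<Longrightarrow> shift G (inv k) x h = x (k \<otimes> h)"
  by (simp add: shift_def)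

lemma shift_apply_mult:
  "g \<in> carrier G \<Longrightarrow> h \<in> carrier G \<Longrightarrow> shift G g x (g \<otimes> h) = x h"
  by (simp add: shift_def m_assoc[symmetric])

end

section \<open>Images of microstates under block maps\<close>

text \<open>
An injective continuous equivariant map reads the symbol of \<open>f x\<close> at the identity off a finite
window \<open>N\<close> of \<open>x\<close>, and the symbol of \<open>x\<close> at the identity can be read off a finite window \<open>N'\<close> of \<open>f x\<close>.
\<close>

locale block_map = shift_invariant G A X
  for G :: "('g, 'm) monoid_scheme" (structure) and A :: "'a set" and X :: "('g \<Rightarrow> 'a) set" +
  fixes f :: "('g \<Rightarrow> 'a) \<Rightarrow> 'g \<Rightarrow> 'a" and N N' :: "'g set"
  assumes f_closed: "\<And>x. x \<in> X \<Longrightarrow> f x \<in> X"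
    and equivariant: "\<And>g x. g \<in> carrier G \<Longrightarrow> x \<in> X \<Longrightarrow> f (shift G g x) = shift G g (f x)"
    and N_sub: "N \<subseteq> carrier G" and N'_sub: "N' \<subseteq> carrier G"
    and memory: "\<And>x y. x \<in> X \<Longrightarrow> y \<in> X \<Longrightarrow> (\<And>h. h \<in> N \<Longrightarrow> x h = y h) \<Longrightarrow> f x \<one> = f y \<one>"
    and inverse_memory: "\<And>x y. x \<in> X \<Longrightarrow> y \<in> X \<Longrightarrow> (\<And>h. h \<in> N' \<Longrightarrow> f x h = f y h) \<Longrightarrow> x \<one> = y \<one>"
begin

text \<open>
The local rule of \<open>f\<close>, applied to an arbitrary colouring. Where the rule has no valid
input, some symbol of \<open>A\<close> is written; such sites are few in a microstate.
\<close>

definition block_image :: "('g \<Rightarrow> 'b \<Rightarrow> 'b) \<Rightarrow> 'b set \<Rightarrow> ('b \<Rightarrow> 'a) \<Rightarrow> 'b \<Rightarrow> 'a" where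
  "block_image \<tau> I c = (\<lambda>a\<in>I.
     if admissible_at \<tau> X N c a then f (SOME x. x \<in> X \<and> (\<forall>h\<in>N. c (\<tau> h a) = x h)) \<one>
     else SOME s. s \<in> A)"

lemma block_image_closed:
  assumes "c \<in> I \<rightarrow>\<^sub>E A" shows "block_image \<tau> I c \<in> I \<rightarrow>\<^sub>E A"
proof (rule PiE_I)
  fix a assume a: "a \<in> I"
  show "block_image \<tau> I c a \<in> A"
  proof (cases "admissible_at \<tau> X N c a")
    case True
    then have "\<exists>x. x \<in> X \<and> (\<forall>h\<in>N. c (\<tau> h a) = x h)" by (auto simp: admissible_at_def)
    from someI_ex[OF this] have "(SOME x. x \<in> X \<and> (\<forall>h\<in>N. c (\<tau> h a) = x h)) \<in> X" by blast
    from X_value[OF f_closed[OF this] one_closed] show ?thesis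
      using True a by (simp add: block_image_def)
  next
    case False
    have "c a \<in> A" using assms a by auto
    then show ?thesis using False a someI[of "\<lambda>s. s \<in> A"] by (simp add: block_image_def)
  qed
qed (simp add: block_image_def)

text \<open>
By equivariance \<open>f y k\<close> is the symbol at the identity of the image of the translate of \<open>y\<close> by the inverse of \<open>k\<close>,
and at a regular site this translate is the name of \<open>\<tau> k b\<close>.
\<close>

lemma block_image_eq:
  assumes reg: "regular_at G \<tau> Q b" and Q: "V \<union> N \<subseteq> Q" and V: "V \<subseteq> carrier G"
    and y: "y \<in> X" "\<And>h. h \<in> V <#> N \<Longrightarrow> c (\<tau> h b) = y h"
    and k: "k \<in> V" "\<tau> k b \<in> I"
  shows "block_image \<tau> I c (\<tau> k b) = f y k"
proof -
  have kG: "k \<in> carrier G" using k V by auto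
  let ?x = "shift G (inv k) y"
  have x: "?x \<in> X" using y kG by (intro shift_closed) auto
  have eq: "c (\<tau> h (\<tau> k b)) = ?x h" if h: "h \<in> N" for h
  proof -
    have "k \<in> Q" "h \<in> Q" using Q k h by auto
    then have "\<tau> h (\<tau> k b) = \<tau> (k \<otimes> h) b" using reg by (simp add: regular_at_def)
    moreover have "k \<otimes> h \<in> V <#> N" using k h by (auto simp: set_mult_def)
    ultimately show ?thesis using y(2) shift_inv_apply[OF kG, of h y] h N_sub by auto
  qed
  then have ex: "\<exists>x. x \<in> X \<and> (\<forall>h\<in>N. c (\<tau> h (\<tau> k b)) = x h)" using x by auto
  define z where "z = (SOME x. x \<in> X \<and> (\<forall>h\<in>N. c (\<tau> h (\<tau> k b)) = x h))"
  have z: "z \<in> X" "\<forall>h\<in>N. c (\<tau> h (\<tau> k b)) = z h"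
    using someI_ex[OF ex] unfolding z_def by blast+
  have "admissible_at \<tau> X N c (\<tau> k b)" using ex unfolding admissible_at_def by blast
  then have "block_image \<tau> I c (\<tau> k b) = f z \<one>" using k by (simp add: block_image_def z_def)
  also have "\<dots> = f ?x \<one>"
  proof (rule memory[OF z(1) x])
    show "z h = ?x h" if "h \<in> N" for h using z(2) eq[OF that] that by simp
  qed
  also have "\<dots> = f y k" using equivariant[of "inv k" y] y kG by (simp add: shift_inv_apply)
  finally show ?thesis .
qed

text \<open>
The local rule maps microstates of \<open>X\<close> to microstates of \<open>f ` X\<close>, and it is almost injective: two
microstates with the same image agree at every regular site that is admissible for both, because the
window \<open>N'\<close> of the image determines the symbol. Hence every fibre lies in a small Hamming ball.
\<close>

lemma block_image_microstates_card:
  assumes I: "finite I" and perm: "\<And>g. g \<in> carrier G \<Longrightarrow> \<tau> g permutes I"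
    and W: "W \<subseteq> carrier G"
    and V_def: "V = insert \<one> (W \<union> N')" and W'_def: "W' = insert \<one> (V <#> N)"
    and Q: "V \<union> N \<subseteq> Q"
    and irr: "real (card {a \<in> I. \<not> regular_at G \<tau> Q a}) \<le> \<zeta> * real (card I)"
    and le: "\<eta>' + \<zeta> \<le> \<eta>" and m: "(2 * \<eta>' + \<zeta>) * real (card I) < real m + 1"
  shows "real (card (microstates \<tau> I A X W' \<eta>'))
      \<le> (\<Sum>S | S \<subseteq> I \<and> card S \<le> m. real (card A) ^ card S)
         * real (card (microstates \<tau> I A (f ` X) W \<eta>))"
proof (rule card_le_fibres)
  let ?F = "block_image \<tau> I"
  let ?M = "microstates \<tau> I A X W' \<eta>'"
  show "finite ?M" "finite (microstates \<tau> I A (f ` X) W \<eta>)"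
    using I finite_A by (auto intro: finite_microstates)
  have V: "V \<subseteq> carrier G" using W N'_sub by (auto simp: V_def)
  have kI: "\<tau> k b \<in> I" if "b \<in> I" "k \<in> V" for b k
    using that V permutes_in_image[OF perm, of k b] by auto
  have code: "?F c (\<tau> k b) = f y k"
    if "b \<in> I" "regular_at G \<tau> Q b" "y \<in> X" "\<forall>h\<in>W'. c (\<tau> h b) = y h" "k \<in> V" for b y c k
    using that kI by (intro block_image_eq[OF _ Q V]) (auto simp: W'_def)
  show "?F ` ?M \<subseteq> microstates \<tau> I A (f ` X) W \<eta>"
  proof (rule image_subsetI)
    fix c assume c: "c \<in> ?M"
    show "?F c \<in> microstates \<tau> I A (f ` X) W \<eta>"
    proof (rule microstatesI[OF I c _ irr le])
      show "?F c \<in> I \<rightarrow>\<^sub>E A" using c by (intro block_image_closed) (simp add: microstates_def)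
      fix a assume a: "a \<in> I" "regular_at G \<tau> Q a" "admissible_at \<tau> X W' c a"
      then obtain y where y: "y \<in> X" "\<forall>h\<in>W'. c (\<tau> h a) = y h" by (auto simp: admissible_at_def)
      have "\<forall>k\<in>W. ?F c (\<tau> k a) = f y k" using code[OF a(1,2) y] by (auto simp: V_def)
      then show "admissible_at \<tau> (f ` X) W (?F c) a" using y by (auto simp: admissible_at_def)
    qed
  qed
  fix e assume "e \<in> microstates \<tau> I A (f ` X) W \<eta>"
  show "real (card {c \<in> ?M. ?F c = e}) \<le> (\<Sum>S | S \<subseteq> I \<and> card S \<le> m. real (card A) ^ card S)"
  proof (cases "\<exists>c0. c0 \<in> ?M \<and> ?F c0 = e")
    case False
    then have "{c \<in> ?M. ?F c = e} = {}" by blast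
    then show ?thesis by (simp only: card.empty of_nat_0) (intro sum_nonneg, simp)
  next
    case True
    then obtain c0 where c0: "c0 \<in> ?M" "?F c0 = e" by blast
    have "{c \<in> ?M. ?F c = e} \<subseteq> {c \<in> I \<rightarrow>\<^sub>E A. card {a \<in> I. c a \<noteq> c0 a} \<le> m}"
    proof clarify
      fix c assume c: "c \<in> ?M" "e = ?F c"
      have same: "c a = c0 a"
        if a: "a \<in> I" "regular_at G \<tau> Q a" and adm: "admissible_at \<tau> X W' c a" "admissible_at \<tau> X W' c0 a"
        for a
      proof -
        obtain y y0 where y: "y \<in> X" "\<forall>h\<in>W'. c (\<tau> h a) = y h"
          and y0: "y0 \<in> X" "\<forall>h\<in>W'. c0 (\<tau> h a) = y0 h"
          using adm by (auto simp: admissible_at_def)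
        have "f y h = f y0 h" if "h \<in> N'" for h
          using code[OF a y, of h] code[OF a y0, of h] that c(2) c0(2) by (auto simp: V_def)
        from inverse_memory[OF y(1) y0(1) this] have "y \<one> = y0 \<one>" .
        then have "c (\<tau> \<one> a) = c0 (\<tau> \<one> a)" using y y0 by (auto simp: W'_def)
        \<comment> \<open>At a regular site \<open>\<tau> \<one>\<close> is idempotent, and it is injective.\<close>
        moreover have "\<tau> \<one> a = a"
        proof -
          have "\<one> \<in> Q" using Q by (auto simp: V_def)
          then have "\<tau> (\<one> \<otimes> \<one>) a = \<tau> \<one> (\<tau> \<one> a)" using a(2) unfolding regular_at_def by blast
          then have "\<tau> \<one> (\<tau> \<one> a) = \<tau> \<one> a" by simp
          then show ?thesis by (rule injD[OF permutes_inj[OF perm[OF one_closed]]])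
        qed
        ultimately show ?thesis by simp
      qed
      have "card {a \<in> I. c a \<noteq> c0 a} \<le> card ({a \<in> I. \<not> admissible_at \<tau> X W' c a}
          \<union> {a \<in> I. \<not> admissible_at \<tau> X W' c0 a} \<union> {a \<in> I. \<not> regular_at G \<tau> Q a})"
        using I same by (intro card_mono) auto
      also have "\<dots> \<le> card {a \<in> I. \<not> admissible_at \<tau> X W' c a}
          + card {a \<in> I. \<not> admissible_at \<tau> X W' c0 a} + card {a \<in> I. \<not> regular_at G \<tau> Q a}"
        by (intro order.trans[OF card_Un_le] add_mono card_Un_le order.refl)
      finally have "real (card {a \<in> I. c a \<noteq> c0 a})
          \<le> \<eta>' * real (card I) + \<eta>' * real (card I) + \<zeta> * real (card I)"
        using c(1) c0(1) irr by (simp add: microstates_def)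
      also have "\<dots> < real m + 1" using m by (simp add: algebra_simps)
      finally have "card {a \<in> I. c a \<noteq> c0 a} \<le> m" by linarith
      then show "c \<in> I \<rightarrow>\<^sub>E A \<and> card {a \<in> I. c a \<noteq> c0 a} \<le> m"
        using c(1) by (simp add: microstates_def)
    qed
    then have "card {c \<in> ?M. ?F c = e} \<le> card {c \<in> I \<rightarrow>\<^sub>E A. card {a \<in> I. c a \<noteq> c0 a} \<le> m}"
      using I finite_A by (intro card_mono finite_subset[OF _ finite_PiE[of I "\<lambda>_. A"]]) auto
    then show ?thesis using hamming_ball_card_le[OF finite_A I, of c0 m] by linarith
  qed
qed

end

section \<open>Planting a pattern\<close>

text \<open>
The pattern \<open>p\<close> on \<open>D\<close> is to be planted into points of \<open>X\<close> by changing them on \<open>E\<close> alone; the collar \<open>M - E\<close> is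
what the new content of \<open>E\<close> has to match. Strong irreducibility provides contents that match a given
collar, and splicability says that matching the collar is enough to stay in \<open>X\<close>.
\<close>

locale patching = shift_invariant G A X
  for G :: "('g, 'm) monoid_scheme" (structure) and A :: "'a set" and X :: "('g \<Rightarrow> 'a) set" +
  fixes D E M :: "'g set" and p :: "'g \<Rightarrow> 'a"
  assumes DE: "D \<subseteq> E" and EM: "E \<subseteq> M" and M_sub: "M \<subseteq> carrier G" and finite_M: "finite M"
    and fillable: "\<And>x. x \<in> X \<Longrightarrow> \<exists>u\<in>X. (\<forall>h\<in>D. u h = p h) \<and> (\<forall>h\<in>M - E. u h = x h)"
    and splice: "\<And>g x y. g \<in> carrier G \<Longrightarrow> x \<in> X \<Longrightarrow> y \<in> X \<Longrightarrow>
        (\<And>h. h \<in> M - E \<Longrightarrow> x (g \<otimes> h) = y (g \<otimes> h)) \<Longrightarrow>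
        (\<lambda>k. if k \<in> (\<lambda>h. g \<otimes> h) ` E then x k else y k) \<in> X"
begin

text \<open>
A choice of content that looks at \<open>v\<close> on the collar only (see \<open>fill_cong\<close>). Therefore it can be
made for a site of a colouring and for a point of \<open>X\<close> with the same result.
\<close>

definition fill :: "('g \<Rightarrow> 'a) \<Rightarrow> 'g \<Rightarrow> 'a" where
  "fill v = (SOME u. u \<in> X \<and> (\<forall>h\<in>D. u h = p h) \<and> (\<forall>h\<in>M - E. u h = v h))"

lemma fill_cong:
  assumes "\<And>h. h \<in> M - E \<Longrightarrow> v h = w h" shows "fill v = fill w"
proof -
  have "(\<lambda>u. u \<in> X \<and> (\<forall>h\<in>D. u h = p h) \<and> (\<forall>h\<in>M - E. u h = v h))
      = (\<lambda>u. u \<in> X \<and> (\<forall>h\<in>D. u h = p h) \<and> (\<forall>h\<in>M - E. u h = w h))"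
    using assms by auto
  then show ?thesis by (simp only: fill_def)
qed

lemma fill:
  assumes "x \<in> X" "\<And>h. h \<in> M - E \<Longrightarrow> v h = x h"
  shows "fill v \<in> X" "\<And>h. h \<in> D \<Longrightarrow> fill v h = p h" "\<And>h. h \<in> M - E \<Longrightarrow> fill v h = v h"
proof -
  have "\<exists>u. u \<in> X \<and> (\<forall>h\<in>D. u h = p h) \<and> (\<forall>h\<in>M - E. u h = v h)"
    using fillable[OF assms(1)] assms(2) by auto
  from someI_ex[OF this]
  show "fill v \<in> X" "\<And>h. h \<in> D \<Longrightarrow> fill v h = p h" "\<And>h. h \<in> M - E \<Longrightarrow> fill v h = v h"
    by (auto simp: fill_def)
qed

text \<open>
The patches are inserted one after the other. Each leaves the collars of the others
untouched, and splicing gives a point of \<open>X\<close> every time, so no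
errors accumulate, however many patches there are. This is the reason why the number of sites that can be
patched, and with it the entropy gained, does not depend on the window on which the result is tested.
\<close>

lemma fill_configuration:
  assumes "finite R" "R \<subseteq> carrier G" "y \<in> X"
    and "\<And>g g'. g \<in> R \<Longrightarrow> g' \<in> R \<Longrightarrow> g \<noteq> g' \<Longrightarrow> (\<lambda>h. g \<otimes> h) ` M \<inter> (\<lambda>h. g' \<otimes> h) ` E = {}"
  shows "\<exists>z\<in>X. (\<forall>g\<in>R. \<forall>h\<in>E. z (g \<otimes> h) = fill (\<lambda>h. y (g \<otimes> h)) h)
      \<and> (\<forall>k. (\<forall>g\<in>R. k \<notin> (\<lambda>h. g \<otimes> h) ` E) \<longrightarrow> z k = y k)"
  using assms
proof (induction R rule: finite_induct)
  case empty
  then show ?case by auto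
next
  case (insert g R)
  then obtain z where z: "z \<in> X" "\<And>g h. g \<in> R \<Longrightarrow> h \<in> E \<Longrightarrow> z (g \<otimes> h) = fill (\<lambda>h. y (g \<otimes> h)) h"
    and off: "\<And>k. (\<forall>g\<in>R. k \<notin> (\<lambda>h. g \<otimes> h) ` E) \<Longrightarrow> z k = y k"
    using insert.IH[OF _ insert.prems(2)] insert.prems(1,3) by (auto 0 3)
  have g: "g \<in> carrier G" using insert.prems by auto
  have disj: "(\<lambda>h. g \<otimes> h) ` M \<inter> (\<lambda>h. g' \<otimes> h) ` E = {}" "(\<lambda>h. g' \<otimes> h) ` M \<inter> (\<lambda>h. g \<otimes> h) ` E = {}"
    if "g' \<in> R" for g'
    using insert.prems(3)[of g g'] insert.prems(3)[of g' g] insert.hyps that by auto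
  have zM: "z (g \<otimes> h) = y (g \<otimes> h)" if "h \<in> M" for h
    using disj(1) that by (intro off) blast
  let ?v = "\<lambda>h. y (g \<otimes> h)"
  have fv: "fill ?v \<in> X" "\<And>h. h \<in> M - E \<Longrightarrow> fill ?v h = ?v h"
    using fill[of "shift G (inv g) y" ?v] insert.prems(2) g M_sub shift_closed[of "inv g" y]
    by (auto simp: shift_inv_apply subset_iff)
  define w where "w = shift G g (fill ?v)"
  have w: "w \<in> X" using fv g by (simp add: w_def shift_closed)
  have wM: "w (g \<otimes> h) = fill ?v h" if "h \<in> M" for h
    using that M_sub g by (auto simp: w_def shift_apply_mult)
  let ?z = "\<lambda>k. if k \<in> (\<lambda>h. g \<otimes> h) ` E then w k else z k"
  have "?z \<in> X" using fv(2) wM zM by (intro splice g w z(1)) auto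
  moreover have "?z (g' \<otimes> h) = fill (\<lambda>h. y (g' \<otimes> h)) h" if "g' \<in> insert g R" "h \<in> E" for g' h
  proof (cases "g' = g")
    case True
    then show ?thesis using wM that EM by auto
  next
    case False
    then have "g' \<in> R" using that by auto
    moreover have "g' \<otimes> h \<notin> (\<lambda>h. g \<otimes> h) ` E" using disj(2)[OF \<open>g' \<in> R\<close>] that EM by blast
    ultimately show ?thesis using z(2) that by auto
  qed
  moreover have "?z k = y k" if "\<forall>g'\<in>insert g R. k \<notin> (\<lambda>h. g' \<otimes> h) ` E" for k
    using that off[of k] by auto
  ultimately show ?case by (intro bexI[of _ ?z]) auto
qed

text \<open>
The pair \<open>(a, h)\<close> is unique when \<open>S\<close> is separated in the sense defined next.
\<close>

definition patch :: "('g \<Rightarrow> 'b \<Rightarrow> 'b) \<Rightarrow> 'b set \<Rightarrow> ('b \<Rightarrow> 'a) \<Rightarrow> 'b \<Rightarrow> 'a" where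
  "patch \<tau> S c b =
     (if \<exists>a\<in>S. \<exists>h\<in>E. b = \<tau> h a
      then (let (a, h) = (SOME (a, h). a \<in> S \<and> h \<in> E \<and> b = \<tau> h a) in fill (\<lambda>k. c (\<tau> k a)) h)
      else c b)"

definition separated :: "('g \<Rightarrow> 'b \<Rightarrow> 'b) \<Rightarrow> 'b set \<Rightarrow> bool" where
  "separated \<tau> T \<longleftrightarrow> (\<forall>a\<in>T. \<forall>a'\<in>T. \<forall>h\<in>M. \<forall>h'\<in>M. \<tau> h a = \<tau> h' a' \<longrightarrow> a = a' \<and> h = h')"

lemma separatedD:
  "separated \<tau> T \<Longrightarrow> a \<in> T \<Longrightarrow> a' \<in> T \<Longrightarrow> h \<in> M \<Longrightarrow> h' \<in> M \<Longrightarrow> \<tau> h a = \<tau> h' a' \<Longrightarrow> a = a' \<and> h = h'"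
  by (auto simp: separated_def)

lemma patch_on:
  assumes "separated \<tau> S" "a \<in> S" "h \<in> E"
  shows "patch \<tau> S c (\<tau> h a) = fill (\<lambda>k. c (\<tau> k a)) h"
proof -
  have "(SOME (a', h'). a' \<in> S \<and> h' \<in> E \<and> \<tau> h a = \<tau> h' a') = (a, h)"
    using assms EM by (intro some_equality) (auto dest: separatedD)
  then show ?thesis using assms by (auto simp: patch_def)
qed

lemma patch_off: "(\<And>a h. a \<in> S \<Longrightarrow> h \<in> E \<Longrightarrow> b \<noteq> \<tau> h a) \<Longrightarrow> patch \<tau> S c b = c b"
  by (auto simp: patch_def)

lemma separated_subset: "separated \<tau> T \<Longrightarrow> S \<subseteq> T \<Longrightarrow> separated \<tau> S"
  by (auto simp: separated_def)

lemma patch_closed: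
  assumes c: "c \<in> I \<rightarrow>\<^sub>E A" and perm: "\<And>g. g \<in> carrier G \<Longrightarrow> \<tau> g permutes I"
    and S: "separated \<tau> S" "S \<subseteq> I" and adm: "\<And>a. a \<in> S \<Longrightarrow> admissible_at \<tau> X M c a"
  shows "patch \<tau> S c \<in> I \<rightarrow>\<^sub>E A"
proof (rule PiE_I)
  fix b assume b: "b \<in> I"
  show "patch \<tau> S c b \<in> A"
  proof (cases "\<exists>a\<in>S. \<exists>h\<in>E. b = \<tau> h a")
    case True
    then obtain a h where ah: "a \<in> S" "h \<in> E" "b = \<tau> h a" by blast
    obtain x where "x \<in> X" "\<forall>h\<in>M. c (\<tau> h a) = x h"
      using adm[OF ah(1)] by (auto simp: admissible_at_def)
    then have "fill (\<lambda>k. c (\<tau> k a)) \<in> X" using fill(1)[of x] by auto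
    then show ?thesis using X_value patch_on[OF S(1) ah(1,2)] ah EM M_sub by auto
  next
    case False
    then have "patch \<tau> S c b = c b" by (intro patch_off) auto
    then show ?thesis using c b by auto
  qed
next
  fix b assume b: "b \<notin> I"
  have "patch \<tau> S c b = c b"
    using b S(2) EM M_sub permutes_in_image[OF perm] by (intro patch_off) (metis subsetD)
  then show "patch \<tau> S c b = undefined" using c b by auto
qed

text \<open>
If \<open>y\<close> extends the name of \<open>b\<close> under \<open>c\<close>, then \<open>y\<close> patched at all \<open>g\<close> with \<open>\<tau> g b \<in> S\<close>
extends the name of \<open>b\<close> under the patched colouring. Only the \<open>g\<close> whose translate of \<open>E\<close> meets \<open>W\<close> matter,
and these form the finite set \<open>V\<close>.
\<close>

lemma patch_admissible:
  assumes perm: "\<And>g. g \<in> carrier G \<Longrightarrow> \<tau> g permutes I"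
    and S: "separated \<tau> S"
    and W: "W \<subseteq> carrier G" "finite W" and V_def: "V = (\<lambda>(k, h). k \<otimes> inv h) ` (W \<times> E)"
    and W'_def: "W' = W \<union> (V <#> M)"
    and Q: "V \<union> M \<subseteq> Q" and reg: "regular_at G \<tau> Q b"
    and adm: "admissible_at \<tau> X W' c b"
  shows "admissible_at \<tau> X W (patch \<tau> S c) b"
proof -
  obtain y where y: "y \<in> X" "\<And>h. h \<in> W' \<Longrightarrow> c (\<tau> h b) = y h"
    using adm by (auto simp: admissible_at_def)
  have E_sub: "E \<subseteq> carrier G" using EM M_sub by auto
  have V: "V \<subseteq> carrier G" using W E_sub by (auto simp: V_def)
  have finV: "finite V" using W finite_subset[OF EM finite_M] by (auto simp: V_def)
  define R where "R = {g \<in> V. \<tau> g b \<in> S}"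
  have mult: "\<tau> (g \<otimes> h) b = \<tau> h (\<tau> g b)" if "g \<in> V" "h \<in> M" for g h
    using reg Q that by (auto simp: regular_at_def)
  \<comment> \<open>Patches do not overlap in the name of \<open>b\<close>: a common point identifies the two sites by
    separation, and then the group elements by freeness at \<open>b\<close>.\<close>
  have same: "g = g' \<and> h = h'" if "g \<in> R" "g' \<in> R" "h \<in> M" "h' \<in> M" "g \<otimes> h = g' \<otimes> h'" for g g' h h'
  proof -
    have "\<tau> h (\<tau> g b) = \<tau> h' (\<tau> g' b)" using that mult[of g h] mult[of g' h'] by (auto simp: R_def)
    then have "\<tau> g b = \<tau> g' b" "h = h'" using separatedD[OF S] that by (auto simp: R_def)
    moreover have "g \<in> Q" "g' \<in> Q" using that Q by (auto simp: R_def)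
    ultimately show ?thesis using reg by (auto simp: regular_at_def dest: inj_onD)
  qed
  have "\<exists>z\<in>X. (\<forall>g\<in>R. \<forall>h\<in>E. z (g \<otimes> h) = fill (\<lambda>h. y (g \<otimes> h)) h)
      \<and> (\<forall>k. (\<forall>g\<in>R. k \<notin> (\<lambda>h. g \<otimes> h) ` E) \<longrightarrow> z k = y k)"
    using finV V y(1) same EM by (intro fill_configuration) (auto simp: R_def)
  then obtain z where z: "z \<in> X"
    and z_on: "\<And>g h. g \<in> R \<Longrightarrow> h \<in> E \<Longrightarrow> z (g \<otimes> h) = fill (\<lambda>h. y (g \<otimes> h)) h"
    and z_off: "\<And>k. (\<forall>g\<in>R. k \<notin> (\<lambda>h. g \<otimes> h) ` E) \<Longrightarrow> z k = y k"
    by metis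
  have "patch \<tau> S c (\<tau> k b) = z k" if k: "k \<in> W" for k
  proof (cases "\<exists>g\<in>R. k \<in> (\<lambda>h. g \<otimes> h) ` E")
    case True
    then obtain g h where gh: "g \<in> R" "h \<in> E" "k = g \<otimes> h" by blast
    then have a: "g \<in> V" "\<tau> g b \<in> S" "h \<in> M" using EM by (auto simp: R_def)
    have "patch \<tau> S c (\<tau> k b) = fill (\<lambda>r. c (\<tau> r (\<tau> g b))) h"
      using patch_on[OF S a(2) gh(2)] mult[OF a(1,3)] gh(3) by simp
    also have "fill (\<lambda>r. c (\<tau> r (\<tau> g b))) = fill (\<lambda>r. y (g \<otimes> r))"
    proof (rule fill_cong)
      fix r assume "r \<in> M - E"
      then have "\<tau> r (\<tau> g b) = \<tau> (g \<otimes> r) b" "g \<otimes> r \<in> W'"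
        using mult[OF a(1), of r] a(1) by (auto simp: W'_def set_mult_def)
      then show "c (\<tau> r (\<tau> g b)) = y (g \<otimes> r)" using y(2) by simp
    qed
    finally show ?thesis using z_on[OF gh(1,2)] gh(3) by simp
  next
    case False
    have "patch \<tau> S c (\<tau> k b) = c (\<tau> k b)"
    proof (rule patch_off, rule notI)
      fix a h assume ah: "a \<in> S" "h \<in> E" "\<tau> k b = \<tau> h a"
      let ?g = "k \<otimes> inv h"
      have hG: "h \<in> carrier G" and kG: "k \<in> carrier G" using ah E_sub k W by auto
      have g: "?g \<in> V" using k ah by (auto simp: V_def)
      have kgh: "k = ?g \<otimes> h" using hG kG by (simp add: m_assoc)
      have "\<tau> h (\<tau> ?g b) = \<tau> h a" using mult[OF g, of h] ah EM kgh by auto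
      then have "\<tau> ?g b = a" using permutes_inj[OF perm[OF hG]] by (auto dest: injD)
      then have "?g \<in> R" using g ah by (auto simp: R_def)
      then show False using False ah(2) kgh by blast
    qed
    also have "\<dots> = y k" using y(2) k by (auto simp: W'_def)
    also have "\<dots> = z k" using False z_off[of k] by auto
    finally show ?thesis .
  qed
  then show ?thesis using z by (auto simp: admissible_at_def)
qed

text \<open>
A site \<open>a\<close> conflicts with at most \<open>(card M)\<^sup>2\<close> sites \<open>b\<close>, since \<open>\<tau> h a = \<tau> k b\<close> determines \<open>b\<close> from \<open>a\<close>, \<open>h\<close> and \<open>k\<close>.
\<close>

lemma exists_separated:
  assumes I: "finite I" and perm: "\<And>g. g \<in> carrier G \<Longrightarrow> \<tau> g permutes I"
    and ne: "M \<noteq> {}" and Q: "M \<subseteq> Q"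
  obtains T where "T \<subseteq> I" "separated \<tau> T"
    "card {a \<in> I. regular_at G \<tau> Q a} \<le> (card M)\<^sup>2 * card T"
proof -
  define conflict where "conflict a b \<longleftrightarrow> (\<exists>h\<in>M. \<exists>k\<in>M. \<tau> h a = \<tau> k b)" for a b
  let ?R = "{a \<in> I. regular_at G \<tau> Q a}"
  have "card {b \<in> ?R. conflict a b} \<le> (card M)\<^sup>2" for a
  proof -
    have "{b \<in> ?R. conflict a b} \<subseteq> (\<lambda>(h, k). Hilbert_Choice.inv (\<tau> k) (\<tau> h a)) ` (M \<times> M)"
    proof clarify
      fix b assume "conflict a b"
      then obtain h k where hk: "h \<in> M" "k \<in> M" "\<tau> h a = \<tau> k b" by (auto simp: conflict_def)
      then have "Hilbert_Choice.inv (\<tau> k) (\<tau> h a) = b"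
        using permutes_inj[OF perm[of k]] M_sub by auto
      then show "b \<in> (\<lambda>(h, k). Hilbert_Choice.inv (\<tau> k) (\<tau> h a)) ` (M \<times> M)" using hk by force
    qed
    then have "card {b \<in> ?R. conflict a b} \<le> card (M \<times> M)"
      using finite_M by (meson card_image_le card_mono finite_SigmaI finite_imageI order.trans)
    then show ?thesis by (simp add: card_cartesian_product power2_eq_square)
  qed
  note deg = this
  have "\<exists>T. T \<subseteq> ?R \<and> pairwise (\<lambda>a b. \<not> conflict a b) T \<and> card ?R \<le> (card M)\<^sup>2 * card T"
  proof (rule exists_large_independent_set[of ?R conflict "(card M)\<^sup>2"])
    show "finite ?R" using I by simp
    show "conflict a a" for a using ne by (auto simp: conflict_def)
    show "conflict b a" if "conflict a b" for a b
      using that unfolding conflict_def by (metis (no_types))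
  qed (use deg in blast)+
  then obtain T where T: "T \<subseteq> ?R" "pairwise (\<lambda>a b. \<not> conflict a b) T"
    "card ?R \<le> (card M)\<^sup>2 * card T" by blast
  have "separated \<tau> T"
    unfolding separated_def
  proof (intro ballI impI)
    fix a a' h h' assume *: "a \<in> T" "a' \<in> T" "h \<in> M" "h' \<in> M" "\<tau> h a = \<tau> h' a'"
    then have aa: "a = a'" using T(2) by (auto simp: pairwise_def conflict_def)
    moreover have "inj_on (\<lambda>s. \<tau> s a) M"
      using T(1) *(1) Q by (auto simp: regular_at_def intro: inj_on_subset)
    ultimately show "a = a' \<and> h = h'" using * by (auto dest: inj_onD)
  qed
  then show ?thesis using that T by auto
qed

text \<open>
Here \<open>marking_count\<close> is applied to microstates of a set \<open>Y\<close> in which the pattern \<open>p\<close> never appears, the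
mark being an occurrence of \<open>p\<close>. An admissible site for \<open>Y\<close> shows no \<open>p\<close> unless \<open>p\<close> was planted there,
so marks that were present from the start sit at the few sites that are not admissible.
\<close>

lemma patch_microstates_card:
  assumes I: "finite I" and perm: "\<And>g. g \<in> carrier G \<Longrightarrow> \<tau> g permutes I" and A: "A \<noteq> {}"
    and T: "separated \<tau> T" "T \<subseteq> I"
    and Y: "Y \<subseteq> X" "\<And>y. y \<in> Y \<Longrightarrow> \<exists>h\<in>D. y h \<noteq> p h"
    and W: "W \<subseteq> carrier G" "finite W" and V_def: "V = (\<lambda>(k, h). k \<otimes> inv h) ` (W \<times> E)"
    and W'_def: "W' = W \<union> M \<union> (V <#> M)" and Q: "V \<union> M \<subseteq> Q"
    and irr: "real (card {a \<in> I. \<not> regular_at G \<tau> Q a}) \<le> \<zeta> * real (card I)"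
    and le: "\<eta>' + \<zeta> \<le> \<eta>" and m: "\<eta>' * real (card I) < real m + 1"
  shows "real (card (microstates \<tau> I A Y W' \<eta>')) * (1 + 1 / real (card A) ^ card E) ^ (card T - m)
      \<le> real (card {B. B \<subseteq> T \<and> card B \<le> m}) * real (card (microstates \<tau> I A X W \<eta>))"
proof (rule marking_count[where I = I and U = "\<lambda>a. (\<lambda>h. \<tau> h a) ` E"
      and G = "\<lambda>c. {a \<in> T. admissible_at \<tau> Y W' c a}" and Phi = "\<lambda>c S. patch \<tau> S c"
      and marked = "\<lambda>c a. \<forall>h\<in>D. c (\<tau> h a) = p h"])
  have finE: "finite E" using finite_M EM finite_subset by auto
  show "finite A" "A \<noteq> {}" "finite I" using finite_A A I by auto
  show finT: "finite T" using T I finite_subset by auto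
  show "microstates \<tau> I A Y W' \<eta>' \<subseteq> I \<rightarrow>\<^sub>E A" "microstates \<tau> I A X W \<eta> \<subseteq> I \<rightarrow>\<^sub>E A"
    by (auto simp: microstates_def)
  show "finite ((\<lambda>h. \<tau> h a) ` E)" "card ((\<lambda>h. \<tau> h a) ` E) \<le> card E" for a
    using finE by (auto intro: card_image_le)
  fix c assume c: "c \<in> microstates \<tau> I A Y W' \<eta>'"
  show "{a \<in> T. admissible_at \<tau> Y W' c a} \<subseteq> T" by blast
  have "card (T - {a \<in> T. admissible_at \<tau> Y W' c a}) \<le> card {a \<in> I. \<not> admissible_at \<tau> Y W' c a}"
    using I T by (intro card_mono) auto
  moreover have "real (card {a \<in> I. \<not> admissible_at \<tau> Y W' c a}) < real m + 1"
    using c m by (simp add: microstates_def)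
  ultimately show "card (T - {a \<in> T. admissible_at \<tau> Y W' c a}) \<le> m" by simp
  fix S assume S: "S \<subseteq> {a \<in> T. admissible_at \<tau> Y W' c a}"
  have sep: "separated \<tau> S" using separated_subset[OF T(1)] S by blast
  show "patch \<tau> S c \<in> microstates \<tau> I A X W \<eta>"
  proof (rule microstatesI[OF I c _ irr le])
    show "patch \<tau> S c \<in> I \<rightarrow>\<^sub>E A"
    proof (rule patch_closed[OF _ perm sep])
      show "c \<in> I \<rightarrow>\<^sub>E A" using c by (simp add: microstates_def)
      show "S \<subseteq> I" using S T by auto
      show "admissible_at \<tau> X M c a" if "a \<in> S" for a
        using that S Y(1) by (intro admissible_at_mono[of \<tau> Y W' c a M X]) (auto simp: W'_def)
    qed
    fix b assume "b \<in> I" and reg: "regular_at G \<tau> Q b" and "admissible_at \<tau> Y W' c b"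
    then have adm: "admissible_at \<tau> X (W \<union> (V <#> M)) c b"
      using Y(1) by (intro admissible_at_mono[of \<tau> Y W' c b _ X]) (auto simp: W'_def)
    show "admissible_at \<tau> X W (patch \<tau> S c) b"
      by (rule patch_admissible[OF _ sep W V_def refl Q reg adm]) (rule perm)
  qed
  show "patch \<tau> S c a = c a" if "a \<notin> (\<Union>b\<in>S. (\<lambda>h. \<tau> h b) ` E)" for a
    using that by (intro patch_off) auto
  fix a assume a: "a \<in> {a \<in> T. admissible_at \<tau> Y W' c a}"
  then obtain y where y: "y \<in> Y" "\<And>h. h \<in> W' \<Longrightarrow> c (\<tau> h a) = y h"
    by (auto simp: admissible_at_def)
  show "(\<forall>h\<in>D. patch \<tau> S c (\<tau> h a) = p h) \<longleftrightarrow> a \<in> S"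
  proof
    assume "a \<in> S"
    then have "patch \<tau> S c (\<tau> h a) = p h" if "h \<in> D" for h
      using patch_on[OF sep, of a h c] subsetD[OF DE that] that
        fill(2)[of y "\<lambda>k. c (\<tau> k a)" h] y Y(1) by (simp add: W'_def subset_iff)
    then show "\<forall>h\<in>D. patch \<tau> S c (\<tau> h a) = p h" by blast
  next
    assume p: "\<forall>h\<in>D. patch \<tau> S c (\<tau> h a) = p h"
    show "a \<in> S"
    proof (rule ccontr)
      assume "a \<notin> S"
      have "y h = p h" if h: "h \<in> D" for h
      proof -
        have hM: "h \<in> M" using h DE EM by auto
        have "patch \<tau> S c (\<tau> h a) = c (\<tau> h a)"
        proof (rule patch_off, rule notI)
          fix a' h' assume *: "a' \<in> S" "h' \<in> E" "\<tau> h a = \<tau> h' a'"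
          then have "a = a'" using separatedD[OF T(1), of a a' h h'] a S hM EM by auto
          then show False using * \<open>a \<notin> S\<close> by simp
        qed
        then show ?thesis using y(2)[of h] p h hM by (auto simp: W'_def)
      qed
      then show False using Y(2)[OF y(1)] by auto
    qed
  qed
qed

end

text \<open>
\<open>E\<close> and \<open>M\<close> are \<open>D\<close> enlarged once by the irreducibility set and then by the splicing set.
\<close>

lemma patchingI:
  assumes "shift_invariant G A X" and "splicable G X" and "strongly_irreducible G X"
    and D: "finite D" "D \<subseteq> carrier G" and p: "p \<in> X"
  obtains E M where "patching G A X D E M p"
proof -
  interpret shift_invariant G A X by fact
  obtain \<Delta>1 where \<Delta>1: "finite \<Delta>1" "\<Delta>1 \<subseteq> carrier G" "\<one>\<^bsub>G\<^esub> \<in> \<Delta>1"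
    and irr: "\<forall>E1 E2 x1 x2. finite E1 \<and> E1 \<subseteq> carrier G \<and> finite E2 \<and> E2 \<subseteq> carrier G \<and>
        (E1 <#>\<^bsub>G\<^esub> \<Delta>1) \<inter> E2 = {} \<and> x1 \<in> X \<and> x2 \<in> X \<longrightarrow>
        (\<exists>z\<in>X. (\<forall>h\<in>E1. z h = x1 h) \<and> (\<forall>h\<in>E2. z h = x2 h))"
    using assms(3) unfolding strongly_irreducible_def by (elim exE conjE) (rule that)
  obtain \<Delta>2 where \<Delta>2: "finite \<Delta>2" "\<Delta>2 \<subseteq> carrier G" "\<one>\<^bsub>G\<^esub> \<in> \<Delta>2"
    and spl: "\<forall>E x y. finite E \<and> E \<subseteq> carrier G \<and> x \<in> X \<and> y \<in> X \<and>
        (\<forall>h \<in> (E <#>\<^bsub>G\<^esub> \<Delta>2) - E. x h = y h) \<longrightarrow> (\<lambda>h. if h \<in> E then x h else y h) \<in> X"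
    using assms(2) unfolding splicable_def by (elim exE conjE) (rule that)
  define E where "E = D <#>\<^bsub>G\<^esub> \<Delta>1"
  define M where "M = E <#>\<^bsub>G\<^esub> \<Delta>2"
  have enlarge: "finite (K <#>\<^bsub>G\<^esub> \<Delta>)" "K <#>\<^bsub>G\<^esub> \<Delta> \<subseteq> carrier G" "K \<subseteq> K <#>\<^bsub>G\<^esub> \<Delta>"
    if "finite K" "K \<subseteq> carrier G" "finite \<Delta>" "\<Delta> \<subseteq> carrier G" "\<one>\<^bsub>G\<^esub> \<in> \<Delta>" for K \<Delta>
  proof -
    show "finite (K <#>\<^bsub>G\<^esub> \<Delta>)" using that by (simp add: set_mult_def)
    show "K <#>\<^bsub>G\<^esub> \<Delta> \<subseteq> carrier G" using that by (intro set_mult_closed)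
    show "K \<subseteq> K <#>\<^bsub>G\<^esub> \<Delta>"
    proof
      fix k assume k: "k \<in> K"
      then have "k = k \<otimes>\<^bsub>G\<^esub> \<one>\<^bsub>G\<^esub>" using that by auto
      then show "k \<in> K <#>\<^bsub>G\<^esub> \<Delta>" using k that(5) unfolding set_mult_def by blast
    qed
  qed
  have E: "finite E" "E \<subseteq> carrier G" "D \<subseteq> E" unfolding E_def by (rule enlarge[OF D \<Delta>1])+
  have M: "finite M" "M \<subseteq> carrier G" "E \<subseteq> M" unfolding M_def by (rule enlarge[OF E(1,2) \<Delta>2])+
  have "patching G A X D E M p"
  proof (unfold_locales)
    show "D \<subseteq> E" "E \<subseteq> M" "M \<subseteq> carrier G" "finite M" using E M by auto
    show "\<exists>u\<in>X. (\<forall>h\<in>D. u h = p h) \<and> (\<forall>h\<in>M - E. u h = x h)" if "x \<in> X" for x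
      using that D M p by (intro irr[rule_format]) (auto simp: E_def)
    fix g x y assume g: "g \<in> carrier G" and xy: "x \<in> X" "y \<in> X"
      and eq: "\<And>h. h \<in> M - E \<Longrightarrow> x (g \<otimes>\<^bsub>G\<^esub> h) = y (g \<otimes>\<^bsub>G\<^esub> h)"
    show "(\<lambda>k. if k \<in> (\<lambda>h. g \<otimes>\<^bsub>G\<^esub> h) ` E then x k else y k) \<in> X"
    proof (rule spl[rule_format], intro conjI xy)
      show "finite ((\<lambda>h. g \<otimes>\<^bsub>G\<^esub> h) ` E)" "(\<lambda>h. g \<otimes>\<^bsub>G\<^esub> h) ` E \<subseteq> carrier G" using E g by auto
      show "\<forall>k\<in>((\<lambda>h. g \<otimes>\<^bsub>G\<^esub> h) ` E <#>\<^bsub>G\<^esub> \<Delta>2) - (\<lambda>h. g \<otimes>\<^bsub>G\<^esub> h) ` E. x k = y k"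
      proof
        fix k assume k: "k \<in> ((\<lambda>h. g \<otimes>\<^bsub>G\<^esub> h) ` E <#>\<^bsub>G\<^esub> \<Delta>2) - (\<lambda>h. g \<otimes>\<^bsub>G\<^esub> h) ` E"
        then obtain h \<delta> where h: "h \<in> E" "\<delta> \<in> \<Delta>2" "k = g \<otimes>\<^bsub>G\<^esub> h \<otimes>\<^bsub>G\<^esub> \<delta>"
          by (auto simp: set_mult_def)
        then have kg: "k = g \<otimes>\<^bsub>G\<^esub> (h \<otimes>\<^bsub>G\<^esub> \<delta>)" using g E \<Delta>2 by (auto simp: m_assoc subset_iff)
        have "h \<otimes>\<^bsub>G\<^esub> \<delta> \<in> M" using h unfolding M_def set_mult_def by blast
        moreover have "h \<otimes>\<^bsub>G\<^esub> \<delta> \<notin> E" using k kg by blast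
        ultimately have "h \<otimes>\<^bsub>G\<^esub> \<delta> \<in> M - E" by blast
        then show "x k = y k" using eq kg by simp
      qed
    qed
  qed
  then show ?thesis by (rule that)
qed

section \<open>Compactness\<close>

lemma compact_finite_subfamily:
  assumes Z: "compact_space Z" and B: "closedin Z B" and C: "\<And>h. h \<in> H \<Longrightarrow> closedin Z (C h)"
    and empty: "\<And>z. z \<in> B \<Longrightarrow> \<exists>h\<in>H. z \<notin> C h"
  obtains N where "N \<subseteq> H" "finite N" "\<And>z. z \<in> B \<Longrightarrow> \<exists>h\<in>N. z \<notin> C h"
proof -
  have "compactin Z B" using Z B by (rule closedin_compact_space)
  then have fip: "\<forall>\<U>. (\<forall>C\<in>\<U>. closedin Z C) \<and> (\<forall>\<F>. finite \<F> \<and> \<F> \<subseteq> \<U> \<longrightarrow> B \<inter> \<Inter>\<F> \<noteq> {})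
      \<longrightarrow> B \<inter> \<Inter>\<U> \<noteq> {}"
    by (simp add: compactin_fip)
  have "B \<inter> \<Inter>(C ` H) = {}" using empty by blast
  then obtain \<F> where \<F>: "finite \<F>" "\<F> \<subseteq> C ` H" "B \<inter> \<Inter>\<F> = {}"
    using fip[rule_format, of "C ` H"] C by blast
  then obtain N where N: "N \<subseteq> H" "finite N" "\<F> = C ` N" by (meson finite_subset_image)
  show ?thesis
  proof (rule that[OF N(1,2)])
    show "\<exists>h\<in>N. z \<notin> C h" if "z \<in> B" for z using \<F>(3) that unfolding N(3) by blast
  qed
qed

lemma topspace_full_shift: "topspace (full_shift G A) = carrier G \<rightarrow>\<^sub>E A"
  by (simp add: full_shift_def)

lemma compact_subshift:
  assumes "finite A" "closedin (full_shift G A) X"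
  shows "compact_space (subtopology (full_shift G A) X)"
proof -
  have "compact_space (full_shift G A)"
    using assms(1)
    by (simp add: full_shift_def compact_space_product_topology compact_space_discrete_topology)
  then show ?thesis using assms(2) by (metis closedin_compact_space compact_space_subtopology)
qed

lemma continuous_map_symbol:
  assumes "continuous_map Z (full_shift G A) g" "h \<in> carrier G"
  shows "continuous_map Z (discrete_topology A) (\<lambda>z. g z h)"
  using continuous_map_compose[OF assms(1)[unfolded full_shift_def]
      continuous_map_product_projection[OF assms(2)]]
  by (simp add: o_def)

lemma closedin_symbol_relation:
  assumes g: "continuous_map Z (discrete_topology A) g" and g': "continuous_map Z (discrete_topology A) g'"
  shows "closedin Z {z \<in> topspace Z. P (g z) (g' z)}"
proof -
  have "continuous_map Z (discrete_topology (A \<times> A)) (\<lambda>z. (g z, g' z))"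
    using g g' by (simp add: prod_topology_discrete_topology continuous_map_pairedI)
  moreover have "closedin (discrete_topology (A \<times> A)) {(s, s') \<in> A \<times> A. P s s'}" by auto
  ultimately have "closedin Z {z \<in> topspace Z. (g z, g' z) \<in> {(s, s') \<in> A \<times> A. P s s'}}"
    by (rule closedin_continuous_map_preimage)
  moreover have "{z \<in> topspace Z. (g z, g' z) \<in> {(s, s') \<in> A \<times> A. P s s'}}
      = {z \<in> topspace Z. P (g z) (g' z)}"
    using continuous_map_image_subset_topspace[OF g] continuous_map_image_subset_topspace[OF g']
    by auto
  ultimately show ?thesis by simp
qed

text \<open>
The pairs \<open>(x, y)\<close> with \<open>v x k \<noteq> v y k\<close> form a compact set, which is covered by the open sets of pairs with
\<open>u x h \<noteq> u y h\<close>. With \<open>u\<close> the identity and \<open>v = f\<close> this yields a finite memory for \<open>f\<close>; with the roles exchanged it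
yields one for the inverse of an injective \<open>f\<close>.
\<close>

lemma finite_determination:
  fixes u v :: "('g \<Rightarrow> 'a) \<Rightarrow> 'g \<Rightarrow> 'a"
  assumes K: "compact_space (subtopology (full_shift G A) X)" and X: "X \<subseteq> carrier G \<rightarrow>\<^sub>E A"
    and u: "continuous_map (subtopology (full_shift G A) X) (full_shift G A) u"
    and v: "continuous_map (subtopology (full_shift G A) X) (full_shift G A) v"
    and k: "k \<in> carrier G"
    and det: "\<And>x y. x \<in> X \<Longrightarrow> y \<in> X \<Longrightarrow> (\<And>h. h \<in> carrier G \<Longrightarrow> u x h = u y h) \<Longrightarrow> v x k = v y k"
  obtains N where "finite N" "N \<subseteq> carrier G"
    "\<And>x y. x \<in> X \<Longrightarrow> y \<in> X \<Longrightarrow> (\<And>h. h \<in> N \<Longrightarrow> u x h = u y h) \<Longrightarrow> v x k = v y k"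
proof -
  let ?K = "subtopology (full_shift G A) X"
  let ?Z = "prod_topology ?K ?K"
  have topK: "topspace ?K = X" using X by (auto simp: topspace_full_shift)
  have fst_snd: "continuous_map ?Z ?K fst" "continuous_map ?Z ?K snd"
    by (simp_all add: continuous_map_fst continuous_map_snd)
  have cl: "closedin ?Z {z \<in> topspace ?Z. P (w (fst z) h) (w (snd z) h)}"
    if "continuous_map ?K (full_shift G A) w" "h \<in> carrier G" for w h and P :: "'a \<Rightarrow> 'a \<Rightarrow> bool"
    using continuous_map_compose[OF fst_snd(1) continuous_map_symbol[OF that]]
      continuous_map_compose[OF fst_snd(2) continuous_map_symbol[OF that]]
    by (intro closedin_symbol_relation) (simp_all add: o_def)
  have compZ: "compact_space ?Z" using K by (simp add: compact_space_prod_topology)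
  have differs: "\<exists>h\<in>carrier G. z \<notin> {z \<in> topspace ?Z. u (fst z) h = u (snd z) h}"
    if "z \<in> {z \<in> topspace ?Z. v (fst z) k \<noteq> v (snd z) k}" for z
  proof -
    from that have z: "fst z \<in> X" "snd z \<in> X" "v (fst z) k \<noteq> v (snd z) k"
      unfolding topspace_prod_topology topK mem_Collect_eq mem_Times_iff by blast+
    then have "\<exists>h\<in>carrier G. u (fst z) h \<noteq> u (snd z) h" using det[of "fst z" "snd z"] by blast
    then show ?thesis by blast
  qed
  obtain N where N: "N \<subseteq> carrier G" "finite N"
    and sep: "\<And>z. z \<in> {z \<in> topspace ?Z. v (fst z) k \<noteq> v (snd z) k} \<Longrightarrow>
      \<exists>h\<in>N. z \<notin> {z \<in> topspace ?Z. u (fst z) h = u (snd z) h}"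
    using compact_finite_subfamily[OF compZ cl[OF v k, of "(\<noteq>)"] cl[OF u, of _ "(=)"] differs]
    by blast
  show ?thesis
  proof (rule that[OF N(2,1)])
    fix x y assume xy: "x \<in> X" "y \<in> X" "\<And>h. h \<in> N \<Longrightarrow> u x h = u y h"
    show "v x k = v y k"
      using sep[of "(x, y)"] xy topK by auto
  qed
qed

lemma missing_pattern:
  assumes K: "compact_space (subtopology (full_shift G A) X)" and X: "X \<subseteq> carrier G \<rightarrow>\<^sub>E A"
    and f: "continuous_map (subtopology (full_shift G A) X) (full_shift G A) f"
    and x: "x \<in> carrier G \<rightarrow>\<^sub>E A" "x \<notin> f ` X"
  obtains D where "finite D" "D \<subseteq> carrier G" "\<And>y. y \<in> f ` X \<Longrightarrow> \<exists>h\<in>D. y h \<noteq> x h"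
proof -
  let ?K = "subtopology (full_shift G A) X"
  have topK: "topspace ?K = X" using X by (auto simp: topspace_full_shift)
  have cl: "closedin ?K {y \<in> topspace ?K. f y h = x h}" if "h \<in> carrier G" for h
    using closedin_symbol_relation[OF continuous_map_symbol[OF f that] continuous_map_symbol[OF f that],
        of "\<lambda>s _. s = x h"] by simp
  have differs: "\<exists>h\<in>carrier G. y \<notin> {y \<in> topspace ?K. f y h = x h}" if y: "y \<in> topspace ?K" for y
  proof -
    from y
    have "f y \<in> carrier G \<rightarrow>\<^sub>E A"
      using continuous_map_image_subset_topspace[OF f] by (auto simp: topspace_full_shift)
    moreover have "f y \<noteq> x" using x y topK by auto
    ultimately have "\<exists>h\<in>carrier G. f y h \<noteq> x h" using x(1) by (meson PiE_ext)
    then show ?thesis by auto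
  qed
  obtain N where N: "N \<subseteq> carrier G" "finite N"
    and sep: "\<And>y. y \<in> topspace ?K \<Longrightarrow> \<exists>h\<in>N. y \<notin> {y \<in> topspace ?K. f y h = x h}"
    using compact_finite_subfamily[OF K closedin_topspace cl differs] by blast
  show ?thesis using sep topK by (intro that[OF N(2,1)]) auto
qed

text \<open>
The sets of points with a given symbol at \<open>k\<close> form an open cover, and \<open>\<epsilon>\<close> is a Lebesgue number for it.
\<close>

lemma metric_determines_symbol:
  assumes metric: "compatible_metric G A X \<rho>" and K: "compact_space (subtopology (full_shift G A) X)"
    and X: "X \<subseteq> carrier G \<rightarrow>\<^sub>E A" and k: "k \<in> carrier G"
  obtains \<epsilon> where "0 < \<epsilon>" "\<And>x y. x \<in> X \<Longrightarrow> y \<in> X \<Longrightarrow> \<rho> x y < \<epsilon> \<Longrightarrow> x k = y k"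
proof -
  interpret Metric_space X \<rho> using metric by (simp add: compatible_metric_def)
  have top: "mtopology = subtopology (full_shift G A) X"
    using metric by (simp add: compatible_metric_def)
  have id: "continuous_map mtopology (full_shift G A) (\<lambda>x. x)"
    unfolding top by (simp add: continuous_map_from_subtopology)
  let ?C = "(\<lambda>s. {x \<in> topspace mtopology. x k \<in> {s}}) ` A"
  have "compactin mtopology X" using K top by (metis compact_space_def topspace_mtopology)
  moreover have "X \<subseteq> \<Union>?C" using X k by auto
  moreover have "openin mtopology U" if "U \<in> ?C" for U
    using that openin_continuous_map_preimage[OF continuous_map_symbol[OF id k], of "{s}" for s]
    by (auto simp del: singleton_iff)
  ultimately obtain \<epsilon> where \<epsilon>: "0 < \<epsilon>" "\<And>x. x \<in> X \<Longrightarrow> \<exists>U\<in>?C. mball x \<epsilon> \<subseteq> U"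
    using lebesgue_number[of X ?C] by blast
  show ?thesis
  proof (rule that[OF \<epsilon>(1)])
    fix x y assume xy: "x \<in> X" "y \<in> X" "\<rho> x y < \<epsilon>"
    obtain s where "mball x \<epsilon> \<subseteq> {x \<in> topspace mtopology. x k \<in> {s}}" using \<epsilon>(2)[OF xy(1)] by auto
    moreover have "x \<in> mball x \<epsilon>" "y \<in> mball x \<epsilon>" using xy \<epsilon>(1) by auto
    ultimately have "x \<in> {x \<in> topspace mtopology. x k \<in> {s}}" "y \<in> {x \<in> topspace mtopology. x k \<in> {s}}"
      by blast+
    then show "x k = y k" by simp
  qed
qed

section \<open>Sofic approximations and nonnegative entropy\<close>

text \<open>
Passing to inverses turns the approximate left action into an approximate right
action, which is the convention of \<open>regular_at\<close>.
\<close>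

definition right_action :: "('g, 'm) monoid_scheme \<Rightarrow> ('g \<Rightarrow> 'b \<Rightarrow> 'b) \<Rightarrow> 'g \<Rightarrow> 'b \<Rightarrow> 'b" where
  "right_action G \<sigma> h = \<sigma> (inv\<^bsub>G\<^esub> h)"

text \<open>
Were the sets of approximately equivariant maps empty for all large \<open>j\<close>, then \<open>log 0 = - \<infinity>\<close> would make the
limit superior \<open>- \<infinity>\<close> for every \<open>\<epsilon>\<close> at once, since \<open>F\<close> and \<open>\<delta>\<close> do not involve \<open>\<epsilon>\<close>.
\<close>

lemma Map_set_nonempty:
  assumes h: "0 \<le> sofic_entropy G X \<rho> d \<sigma>"
    and F: "finite F" "F \<noteq> {}" "F \<subseteq> carrier G" and \<delta>: "0 < \<delta>" and d: "\<And>j. 0 < d j"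
  shows "\<exists>\<^sub>F j in sequentially. Map_set G X \<rho> F \<delta> (d j) (\<sigma> j) \<noteq> {}"
proof (rule ccontr)
  assume "\<not> ?thesis"
  then have ev: "\<forall>\<^sub>F j in sequentially. Map_set G X \<rho> F \<delta> (d j) (\<sigma> j) = {}"
    by (simp add: frequently_def)
  have "(INF F\<in>{F. finite F \<and> F \<noteq> {} \<and> F \<subseteq> carrier G}. INF \<delta>\<in>{0<..}.
        limsup (\<lambda>j. ereal (1 / real (d j)) *
          log_enat (sep_number \<rho> (d j) \<epsilon> (Map_set G X \<rho> F \<delta> (d j) (\<sigma> j))))) \<le> - \<infinity>" for \<epsilon>
  proof (rule INF_lower2[of F], use F in simp, rule INF_lower2[of \<delta>], use \<delta> in simp)
    have "\<forall>\<^sub>F j in sequentially. ereal (1 / real (d j)) *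
          log_enat (sep_number \<rho> (d j) \<epsilon> (Map_set G X \<rho> F \<delta> (d j) (\<sigma> j))) = - \<infinity>"
      using ev
    proof (rule eventually_mono)
      fix j assume "Map_set G X \<rho> F \<delta> (d j) (\<sigma> j) = {}"
      then have "sep_number \<rho> (d j) \<epsilon> (Map_set G X \<rho> F \<delta> (d j) (\<sigma> j)) = Sup {0}"
        unfolding sep_number_def by (intro arg_cong[where f = Sup]) (auto simp: zero_enat_def)
      then have "log_enat (sep_number \<rho> (d j) \<epsilon> (Map_set G X \<rho> F \<delta> (d j) (\<sigma> j))) = - \<infinity>"
        by (simp add: log_enat_def zero_enat_def)
      then show "ereal (1 / real (d j)) *
          log_enat (sep_number \<rho> (d j) \<epsilon> (Map_set G X \<rho> F \<delta> (d j) (\<sigma> j))) = - \<infinity>"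
        using d[of j] by simp
    qed
    from Limsup_eq[OF this]
    show "limsup (\<lambda>j. ereal (1 / real (d j)) *
          log_enat (sep_number \<rho> (d j) \<epsilon> (Map_set G X \<rho> F \<delta> (d j) (\<sigma> j)))) \<le> - \<infinity>"
      by (simp add: Limsup_const)
  qed
  then have "sofic_entropy G X \<rho> d \<sigma> \<le> - \<infinity>"
    unfolding sofic_entropy_def by (intro SUP_least)
  then show False using h by simp
qed

text \<open>
Chebyshev's inequality for the mean square distance.
\<close>

lemma card_far_points_le:
  assumes "0 < d" "rho_2 \<rho> d \<phi> \<psi> < \<delta>" "0 < \<epsilon>"
  shows "\<epsilon>\<^sup>2 * real (card {a \<in> {1..d}. \<epsilon> \<le> \<rho> (\<phi> a) (\<psi> a)}) \<le> \<delta>\<^sup>2 * real d"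
proof -
  let ?s = "\<Sum>a\<in>{1..d}. (\<rho> (\<phi> a) (\<psi> a))\<^sup>2"
  let ?B = "{a \<in> {1..d}. \<epsilon> \<le> \<rho> (\<phi> a) (\<psi> a)}"
  have "\<epsilon>\<^sup>2 * real (card ?B) = (\<Sum>a\<in>?B. \<epsilon>\<^sup>2)" by simp
  also have "\<dots> \<le> (\<Sum>a\<in>?B. (\<rho> (\<phi> a) (\<psi> a))\<^sup>2)"
    using assms(3) by (intro sum_mono power_mono) auto
  also have "\<dots> \<le> ?s" by (intro sum_mono2) auto
  also have "\<dots> \<le> \<delta>\<^sup>2 * real d"
  proof -
    have s: "0 \<le> ?s / real d" by (simp add: sum_nonneg)
    have "sqrt (?s / real d) < \<delta>" using assms(2) by (simp add: rho_2_def)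
    then have "(sqrt (?s / real d))\<^sup>2 \<le> \<delta>\<^sup>2" using s by (intro power_mono) auto
    then show ?thesis using s assms(1) by (simp add: field_simps)
  qed
  finally show ?thesis .
qed

text \<open>
Reading the symbols at the identity turns an approximately equivariant map into a microstate: where \<open>\<phi>\<close> is
\<open>\<epsilon>\<close>-close to equivariant for the inverses of all \<open>h \<in> W\<close>, the name of \<open>a\<close> agrees with \<open>\<phi> a\<close> on \<open>W\<close>.
\<close>

lemma (in shift_invariant) microstates_of_Map_set:
  assumes \<rho>: "0 < \<epsilon>" "\<And>x y. x \<in> X \<Longrightarrow> y \<in> X \<Longrightarrow> \<rho> x y < \<epsilon> \<Longrightarrow> x \<one> = y \<one>"
    and W: "finite W" "W \<subseteq> carrier G" and d: "0 < d"
    and perm: "\<And>g. g \<in> carrier G \<Longrightarrow> \<sigma> g permutes {1..d}"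
    and F: "(\<lambda>h. inv h) ` W \<subseteq> F" and \<delta>: "\<delta>\<^sup>2 * real (card W) \<le> \<eta> * \<epsilon>\<^sup>2"
    and \<phi>: "\<phi> \<in> Map_set G X \<rho> F \<delta> d \<sigma>"
  shows "(\<lambda>a\<in>{1..d}. \<phi> a \<one>) \<in> microstates (right_action G \<sigma>) {1..d} A X W \<eta>"
proof -
  let ?c = "\<lambda>a\<in>{1..d}. \<phi> a \<one>"
  let ?far = "\<lambda>h. {a \<in> {1..d}. \<epsilon> \<le> \<rho> ((\<phi> \<circ> \<sigma> (inv h)) a) (shift G (inv h) (\<phi> a))}"
  have \<phi>X: "\<phi> a \<in> X" if "a \<in> {1..d}" for a using \<phi> that by (auto simp: Map_set_def)
  have c: "?c \<in> {1..d} \<rightarrow>\<^sub>E A" using X_value[OF \<phi>X] by auto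
  have "{a \<in> {1..d}. \<not> admissible_at (right_action G \<sigma>) X W ?c a} \<subseteq> (\<Union>h\<in>W. ?far h)"
  proof
    fix a assume a: "a \<in> {a \<in> {1..d}. \<not> admissible_at (right_action G \<sigma>) X W ?c a}"
    then have "\<not> (\<forall>h\<in>W. ?c (\<sigma> (inv h) a) = \<phi> a h)"
      using \<phi>X unfolding admissible_at_def right_action_def by blast
    then obtain h where h: "h \<in> W" "?c (\<sigma> (inv h) a) \<noteq> \<phi> a h" by blast
    have hG: "h \<in> carrier G" using h W by auto
    have s: "\<sigma> (inv h) a \<in> {1..d}"
      using a permutes_in_image[OF perm[OF inv_closed[OF hG]]] by blast
    have "\<phi> (\<sigma> (inv h) a) \<one> \<noteq> shift G (inv h) (\<phi> a) \<one>"
      using h s hG by (simp add: shift_inv_apply)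
    then have "\<epsilon> \<le> \<rho> (\<phi> (\<sigma> (inv h) a)) (shift G (inv h) (\<phi> a))"
      using \<rho>(2)[OF \<phi>X[OF s] shift_closed[OF inv_closed[OF hG] \<phi>X[of a]]] a
      by (simp add: not_less[symmetric]) blast
    then show "a \<in> (\<Union>h\<in>W. ?far h)" using a h by auto
  qed
  then have "card {a \<in> {1..d}. \<not> admissible_at (right_action G \<sigma>) X W ?c a} \<le> card (\<Union>h\<in>W. ?far h)"
    using W by (intro card_mono) auto
  also have "\<dots> \<le> (\<Sum>h\<in>W. card (?far h))" by (rule card_UN_le[OF W(1)])
  finally have "\<epsilon>\<^sup>2 * real (card {a \<in> {1..d}. \<not> admissible_at (right_action G \<sigma>) X W ?c a})
      \<le> \<epsilon>\<^sup>2 * real (\<Sum>h\<in>W. card (?far h))"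
    using \<rho>(1) by (intro mult_left_mono of_nat_mono) auto
  also have "\<dots> = (\<Sum>h\<in>W. \<epsilon>\<^sup>2 * real (card (?far h)))" by (simp add: sum_distrib_left)
  also have "\<dots> \<le> (\<Sum>h\<in>W. \<delta>\<^sup>2 * real d)"
  proof (rule sum_mono)
    fix h assume "h \<in> W"
    then have "rho_2 \<rho> d (\<phi> \<circ> \<sigma> (inv h)) (\<lambda>a. shift G (inv h) (\<phi> a)) < \<delta>"
      using \<phi> F by (auto simp: Map_set_def)
    from card_far_points_le[OF d this \<rho>(1)]
    show "\<epsilon>\<^sup>2 * real (card (?far h)) \<le> \<delta>\<^sup>2 * real d" .
  qed
  also have "\<dots> = (\<delta>\<^sup>2 * real (card W)) * real d" by simp
  also have "\<dots> \<le> (\<eta> * \<epsilon>\<^sup>2) * real d" using \<delta> by (intro mult_right_mono) auto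
  also have "\<dots> = \<epsilon>\<^sup>2 * (\<eta> * real d)" by simp
  finally have "real (card {a \<in> {1..d}. \<not> admissible_at (right_action G \<sigma>) X W ?c a}) \<le> \<eta> * real d"
    using \<rho>(1) by (simp only: mult_le_cancel_left_pos zero_less_power)
  then show ?thesis using c unfolding microstates_def by simp
qed

lemma eventually_card_Un_le:
  fixes d :: "nat \<Rightarrow> nat"
  assumes P: "finite P" and \<zeta>: "0 < \<zeta>"
    and ev: "\<And>p \<xi>. p \<in> P \<Longrightarrow> 0 < \<xi> \<Longrightarrow>
      \<forall>\<^sub>F j in sequentially. real (card {a \<in> {1..d j}. B j p a}) \<le> \<xi> * real (d j)"
  shows "\<forall>\<^sub>F j in sequentially. real (card {a \<in> {1..d j}. \<exists>p\<in>P. B j p a}) \<le> \<zeta> * real (d j)"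
proof -
  define \<xi> where "\<xi> = \<zeta> / (real (card P) + 1)"
  have \<xi>: "0 < \<xi>" using \<zeta> by (simp add: \<xi>_def)
  have "real (card P) * \<xi> = \<zeta> * (real (card P) / (real (card P) + 1))" by (simp add: \<xi>_def)
  also have "\<dots> \<le> \<zeta> * 1" using \<zeta> by (intro mult_left_mono) auto
  finally have P\<xi>: "real (card P) * \<xi> \<le> \<zeta>" by simp
  have "\<forall>\<^sub>F j in sequentially. \<forall>p\<in>P. real (card {a \<in> {1..d j}. B j p a}) \<le> \<xi> * real (d j)"
    using ev \<xi> by (intro eventually_ball_finite[OF P]) auto
  then show ?thesis
  proof (rule eventually_mono)
    fix j assume j: "\<forall>p\<in>P. real (card {a \<in> {1..d j}. B j p a}) \<le> \<xi> * real (d j)"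
    have "{a \<in> {1..d j}. \<exists>p\<in>P. B j p a} = (\<Union>p\<in>P. {a \<in> {1..d j}. B j p a})" by auto
    then have "card {a \<in> {1..d j}. \<exists>p\<in>P. B j p a} \<le> (\<Sum>p\<in>P. card {a \<in> {1..d j}. B j p a})"
      using card_UN_le[OF P, of "\<lambda>p. {a \<in> {1..d j}. B j p a}"] by (simp only:)
    then have "real (card {a \<in> {1..d j}. \<exists>p\<in>P. B j p a}) \<le> real (\<Sum>p\<in>P. card {a \<in> {1..d j}. B j p a})"
      by (rule of_nat_mono)
    also have "\<dots> = (\<Sum>p\<in>P. real (card {a \<in> {1..d j}. B j p a}))" by (rule of_nat_sum)
    also have "\<dots> \<le> (\<Sum>p\<in>P. \<xi> * real (d j))" using j by (intro sum_mono) auto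
    also have "\<dots> = (real (card P) * \<xi>) * real (d j)" by simp
    also have "\<dots> \<le> \<zeta> * real (d j)" using P\<xi> by (intro mult_right_mono) auto
    finally show "real (card {a \<in> {1..d j}. \<exists>p\<in>P. B j p a}) \<le> \<zeta> * real (d j)" .
  qed
qed

text \<open>
The two limits in the definition of a sofic approximation bound, for each pair \<open>(s, t)\<close> from \<open>Q\<close>, the
proportion of sites where multiplicativity or freeness fails.
\<close>

lemma sofic_eventually_regular:
  assumes "group G" and sofic: "sofic_approximation G d \<sigma>"
    and Q: "finite Q" "Q \<subseteq> carrier G" and \<zeta>: "0 < \<zeta>"
  shows "\<forall>\<^sub>F j in sequentially.
    real (card {a \<in> {1..d j}. \<not> regular_at G (right_action G (\<sigma> j)) Q a}) \<le> \<zeta> * real (d j)"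
proof -
  interpret group G by fact
  have d: "0 < d j" for j using sofic by (simp add: sofic_approximation_def)
  let ?\<tau> = "\<lambda>j. right_action G (\<sigma> j)"
  let ?B = "\<lambda>j (s, t) a. ?\<tau> j (s \<otimes>\<^bsub>G\<^esub> t) a \<noteq> ?\<tau> j t (?\<tau> j s a) \<or> s \<noteq> t \<and> ?\<tau> j s a = ?\<tau> j t a"
  have "\<forall>\<^sub>F j in sequentially. real (card {a \<in> {1..d j}. \<exists>p\<in>Q \<times> Q. ?B j p a}) \<le> \<zeta> * real (d j)"
  proof (rule eventually_card_Un_le[OF _ \<zeta>])
    show "finite (Q \<times> Q)" using Q by simp
    fix p \<xi> assume p: "p \<in> Q \<times> Q" and \<xi>: "0 < (\<xi> :: real)"
    obtain s t where st: "p = (s, t)" "s \<in> carrier G" "t \<in> carrier G" using p Q by (cases p) auto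
    have "(\<lambda>j. hamming (d j) (\<sigma> j (inv\<^bsub>G\<^esub> t) \<circ> \<sigma> j (inv\<^bsub>G\<^esub> s)) (\<sigma> j (inv\<^bsub>G\<^esub> t \<otimes>\<^bsub>G\<^esub> inv\<^bsub>G\<^esub> s))) \<longlonglongrightarrow> 0"
      using sofic st by (simp add: sofic_approximation_def)
    then have 1: "\<forall>\<^sub>F j in sequentially. hamming (d j) (\<sigma> j (inv\<^bsub>G\<^esub> t) \<circ> \<sigma> j (inv\<^bsub>G\<^esub> s))
        (\<sigma> j (inv\<^bsub>G\<^esub> t \<otimes>\<^bsub>G\<^esub> inv\<^bsub>G\<^esub> s)) < \<xi> / 2"
      using \<xi> by (intro order_tendstoD) auto
    have 2: "\<forall>\<^sub>F j in sequentially. s \<noteq> t \<longrightarrow>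
        1 - \<xi> / 2 < hamming (d j) (\<sigma> j (inv\<^bsub>G\<^esub> s)) (\<sigma> j (inv\<^bsub>G\<^esub> t))"
    proof (cases "s = t")
      case False
      then have "inv\<^bsub>G\<^esub> s \<noteq> inv\<^bsub>G\<^esub> t" using st by (metis inv_inv)
      then have "(\<lambda>j. hamming (d j) (\<sigma> j (inv\<^bsub>G\<^esub> s)) (\<sigma> j (inv\<^bsub>G\<^esub> t))) \<longlonglongrightarrow> 1"
        using sofic st by (simp add: sofic_approximation_def)
      then have "\<forall>\<^sub>F j in sequentially. 1 - \<xi> / 2 < hamming (d j) (\<sigma> j (inv\<^bsub>G\<^esub> s)) (\<sigma> j (inv\<^bsub>G\<^esub> t))"
        using \<xi> by (intro order_tendstoD) auto
      then show ?thesis by (rule eventually_mono) simp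
    qed simp
    show "\<forall>\<^sub>F j in sequentially. real (card {a \<in> {1..d j}. ?B j p a}) \<le> \<xi> * real (d j)"
      using 1 2
    proof eventually_elim
      case (elim j)
      let ?B1 = "{a \<in> {1..d j}. (\<sigma> j (inv\<^bsub>G\<^esub> t) \<circ> \<sigma> j (inv\<^bsub>G\<^esub> s)) a \<noteq> \<sigma> j (inv\<^bsub>G\<^esub> t \<otimes>\<^bsub>G\<^esub> inv\<^bsub>G\<^esub> s) a}"
      let ?E = "{a \<in> {1..d j}. \<sigma> j (inv\<^bsub>G\<^esub> s) a = \<sigma> j (inv\<^bsub>G\<^esub> t) a}"
      let ?N = "{a \<in> {1..d j}. \<sigma> j (inv\<^bsub>G\<^esub> s) a \<noteq> \<sigma> j (inv\<^bsub>G\<^esub> t) a}"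
      let ?B2 = "{a \<in> ?E. s \<noteq> t}"
      have B1: "real (card ?B1) \<le> \<xi> / 2 * real (d j)"
        using elim(1) d[of j] by (simp add: hamming_def field_simps)
      have B2: "real (card ?B2) \<le> \<xi> / 2 * real (d j)"
      proof (cases "s = t")
        case False
        then have N: "(1 - \<xi> / 2) * real (d j) < real (card ?N)"
          using elim(2) d[of j] by (simp add: hamming_def field_simps)
        have "card ?E + card ?N = card (?E \<union> ?N)" by (intro card_Un_disjoint[symmetric]) auto
        also have "?E \<union> ?N = {1..d j}" by auto
        finally have "real (card ?E) + real (card ?N) = real (d j)"
          by (simp only: of_nat_add[symmetric] card_atLeastAtMost diff_Suc_1)
        then show ?thesis using N False by (simp add: algebra_simps)
      qed (use \<xi> in simp)
      have "{a \<in> {1..d j}. ?B j p a} \<subseteq> ?B1 \<union> ?B2"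
        using st by (auto simp: right_action_def inv_mult_group)
      then have "card {a \<in> {1..d j}. ?B j p a} \<le> card (?B1 \<union> ?B2)" by (intro card_mono) auto
      also have "\<dots> \<le> card ?B1 + card ?B2" by (rule card_Un_le)
      finally have "real (card {a \<in> {1..d j}. ?B j p a}) \<le> real (card ?B1) + real (card ?B2)"
        by (simp only: of_nat_add[symmetric] of_nat_le_iff)
      then show ?case using B1 B2 by simp
    qed
  qed
  then show ?thesis
  proof (rule eventually_mono)
    fix j
    assume le: "real (card {a \<in> {1..d j}. \<exists>p\<in>Q \<times> Q. ?B j p a}) \<le> \<zeta> * real (d j)"
    have "{a \<in> {1..d j}. \<not> regular_at G (?\<tau> j) Q a} \<subseteq> {a \<in> {1..d j}. \<exists>p\<in>Q \<times> Q. ?B j p a}"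
      by (auto simp: regular_at_def inj_on_def)
    then have "card {a \<in> {1..d j}. \<not> regular_at G (?\<tau> j) Q a} \<le> card {a \<in> {1..d j}. \<exists>p\<in>Q \<times> Q. ?B j p a}"
      by (intro card_mono) auto
    then show "real (card {a \<in> {1..d j}. \<not> regular_at G (?\<tau> j) Q a}) \<le> \<zeta> * real (d j)"
      using le by linarith
  qed
qed

section \<open>Asymptotic counts and surjunctivity\<close>

lemma right_action_permutes:
  assumes "group G" "sofic_approximation G d \<sigma>" "g \<in> carrier G"
  shows "right_action G (\<sigma> j) g permutes {1..d j}"
  using assms group.inv_closed[OF assms(1,3)]
  by (simp add: right_action_def sofic_approximation_def)

lemma nat_floor_bounds:
  fixes x :: real
  assumes "0 \<le> x"
  shows "x < real (nat \<lfloor>x\<rfloor>) + 1" "real (nat \<lfloor>x\<rfloor>) \<le> x"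
  using assms by linarith+

text \<open>
Passing from \<open>X\<close> to \<open>f ` X\<close> loses no entropy. The radius of the Hamming balls that
contain the fibres is \<open>2 * \<zeta> + \<zeta>\<close> per site: the bad sites of two microstates and the irregular ones.
\<close>

lemma (in block_map) block_map_microstates_growth:
  assumes sofic: "sofic_approximation G d \<sigma>" and A: "A \<noteq> {}"
    and fin: "finite N" "finite N'" and W: "finite W" "W \<subseteq> carrier G"
    and \<eta>: "0 < \<eta>" and \<kappa>: "0 < \<kappa>"
  obtains W' \<eta>' where "finite W'" "W' \<subseteq> carrier G" "0 < \<eta>'"
    "\<forall>\<^sub>F j in sequentially.
       real (card (microstates (right_action G (\<sigma> j)) {1..d j} A X W' \<eta>'))
       \<le> exp (\<kappa> * real (d j))
          * real (card (microstates (right_action G (\<sigma> j)) {1..d j} A (f ` X) W \<eta>))"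
proof -
  have "1 \<le> real (card A)" using A finite_A by (simp add: Suc_leI card_gt_0_iff)
  then obtain \<eta>0 where \<eta>0: "0 < \<eta>0"
    and small: "\<And>(I :: nat set) m. finite I \<Longrightarrow> real m \<le> \<eta>0 * real (card I) \<Longrightarrow>
       (\<Sum>S | S \<subseteq> I \<and> card S \<le> m. real (card A) ^ card S) \<le> exp (\<kappa> * real (card I))"
    using small_subsets_weight_subexponential[OF _ \<kappa>] by blast
  define \<zeta> where "\<zeta> = min (\<eta> / 2) (\<eta>0 / 3)"
  have \<zeta>: "0 < \<zeta>" "\<zeta> + \<zeta> \<le> \<eta>" "2 * \<zeta> + \<zeta> \<le> \<eta>0"
    using \<eta> \<eta>0 by (auto simp: \<zeta>_def min_def)
  define V where "V = insert \<one> (W \<union> N')"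
  define W' where "W' = insert \<one> (V <#> N)"
  have V: "finite V" "V \<subseteq> carrier G" using W fin N'_sub by (auto simp: V_def)
  have W': "finite W'" "W' \<subseteq> carrier G"
    using V fin N_sub set_mult_closed[OF V(2) N_sub] by (auto simp: W'_def set_mult_def)
  have VN: "finite (V \<union> N)" "V \<union> N \<subseteq> carrier G" using V fin N_sub by auto
  have "\<forall>\<^sub>F j in sequentially.
       real (card (microstates (right_action G (\<sigma> j)) {1..d j} A X W' \<zeta>))
       \<le> exp (\<kappa> * real (d j))
          * real (card (microstates (right_action G (\<sigma> j)) {1..d j} A (f ` X) W \<eta>))"
    using sofic_eventually_regular[OF is_group sofic VN \<zeta>(1)]
  proof (rule eventually_mono)
    fix j
    let ?\<tau> = "right_action G (\<sigma> j)" and ?I = "{1..d j}"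
    assume irr: "real (card {a \<in> ?I. \<not> regular_at G ?\<tau> (V \<union> N) a}) \<le> \<zeta> * real (d j)"
    define m where "m = nat \<lfloor>(2 * \<zeta> + \<zeta>) * real (card ?I)\<rfloor>"
    have "0 \<le> (2 * \<zeta> + \<zeta>) * real (card ?I)" using \<zeta> by simp
    note m = nat_floor_bounds[OF this, folded m_def]
    have m\<eta>0: "real m \<le> \<eta>0 * real (card ?I)"
      by (rule order.trans[OF m(2) mult_right_mono[OF \<zeta>(3)]]) simp
    have "real (card (microstates ?\<tau> ?I A X W' \<zeta>))
      \<le> (\<Sum>S | S \<subseteq> ?I \<and> card S \<le> m. real (card A) ^ card S)
         * real (card (microstates ?\<tau> ?I A (f ` X) W \<eta>))"
    proof (rule block_image_microstates_card[where V = V and Q = "V \<union> N" and \<zeta> = \<zeta>])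
      show "?\<tau> g permutes ?I" if "g \<in> carrier G" for g
        using that by (rule right_action_permutes[OF is_group sofic])
    qed (use irr W V_def W'_def \<zeta> m in auto)
    also have "\<dots> \<le> exp (\<kappa> * real (card ?I)) * real (card (microstates ?\<tau> ?I A (f ` X) W \<eta>))"
      using small[OF _ m\<eta>0] by (intro mult_right_mono) auto
    finally show "real (card (microstates ?\<tau> ?I A X W' \<zeta>))
      \<le> exp (\<kappa> * real (d j)) * real (card (microstates ?\<tau> ?I A (f ` X) W \<eta>))" by simp
  qed
  then show ?thesis using that W' \<zeta>(1) by blast
qed

text \<open>
Some separated set of sites has density at least
\<open>\<theta> = 1 / (2 * (card M)\<^sup>2)\<close>, as at least half of the sites are regular, and each of its sites
contributes the factor \<open>exp L = 1 + 1 / card A ^ card E\<close>. Up to a quarter of the exponent \<open>\<theta> * L\<close> is given up for inadmissible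
sites and another quarter for choosing the small exceptional sets, so that \<open>c = \<theta> * L / 2\<close> remains. It is essential
that \<open>c\<close> is independent of \<open>W\<close> and \<open>\<eta>\<close>: the estimate is going to be iterated.
\<close>

lemma (in patching) missing_pattern_entropy_gap:
  assumes sofic: "sofic_approximation G d \<sigma>" and A: "A \<noteq> {}" and D: "D \<noteq> {}"
    and Y: "Y \<subseteq> X" "\<And>y. y \<in> Y \<Longrightarrow> \<exists>h\<in>D. y h \<noteq> p h"
  obtains c where "0 < c"
    "\<And>W \<eta>. finite W \<Longrightarrow> W \<subseteq> carrier G \<Longrightarrow> 0 < \<eta> \<Longrightarrow>
       \<exists>W' \<eta>'. finite W' \<and> W' \<subseteq> carrier G \<and> 0 < \<eta>' \<and> (\<forall>\<^sub>F j in sequentially.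
         exp (c * real (d j)) * real (card (microstates (right_action G (\<sigma> j)) {1..d j} A Y W' \<eta>'))
         \<le> real (card (microstates (right_action G (\<sigma> j)) {1..d j} A X W \<eta>)))"
proof -
  define L where "L = ln (1 + 1 / real (card A) ^ card E)"
  define \<theta> where "\<theta> = 1 / (2 * (real (card M))\<^sup>2)"
  have "0 < card A" using A finite_A by (simp add: card_gt_0_iff)
  then have t: "0 < 1 / real (card A) ^ card E" by simp
  then have L: "0 < L" unfolding L_def by (intro ln_gt_zero) linarith
  have M: "M \<noteq> {}" "0 < card M" using D DE EM finite_M by (auto simp: card_gt_0_iff)
  then have \<theta>: "0 < \<theta>" by (simp add: \<theta>_def)
  show ?thesis
  proof (rule that)
    show c: "0 < \<theta> * L / 2" using \<theta> L by simp
    fix W \<eta> assume W: "finite W" "W \<subseteq> carrier G" and \<eta>: "0 < (\<eta> :: real)"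
    obtain \<eta>0 where \<eta>0: "0 < \<eta>0"
      and small: "\<And>(I :: nat set) m. finite I \<Longrightarrow> real m \<le> \<eta>0 * real (card I) \<Longrightarrow>
         (\<Sum>S | S \<subseteq> I \<and> card S \<le> m. 1 ^ card S) \<le> exp (\<theta> * L / 4 * real (card I))"
      using small_subsets_weight_subexponential[of 1 "\<theta> * L / 4"] \<theta> L by auto
    define \<eta>' where "\<eta>' = min (\<eta> / 2) (min (\<theta> / 4) \<eta>0)"
    define \<zeta> where "\<zeta> = min (\<eta> / 2) (1 / 2)"
    have \<eta>': "0 < \<eta>'" "\<eta>' \<le> \<theta> / 4" "\<eta>' \<le> \<eta>0" using \<eta> \<theta> \<eta>0 by (auto simp: \<eta>'_def)
    have \<zeta>: "0 < \<zeta>" "\<zeta> \<le> 1 / 2" "\<eta>' + \<zeta> \<le> \<eta>" using \<eta> by (auto simp: \<zeta>_def \<eta>'_def min_def)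
    define V where "V = (\<lambda>(k, h). k \<otimes> inv h) ` (W \<times> E)"
    define W' where "W' = W \<union> M \<union> (V <#> M)"
    have E: "finite E" "E \<subseteq> carrier G" using EM M_sub finite_M finite_subset by auto
    have V: "finite V" "V \<subseteq> carrier G" using W E by (auto simp: V_def)
    have W': "finite W'" "W' \<subseteq> carrier G"
      using W V finite_M M_sub set_mult_closed[OF V(2) M_sub] by (auto simp: W'_def set_mult_def)
    have VM: "finite (V \<union> M)" "V \<union> M \<subseteq> carrier G" using V finite_M M_sub by auto
    have "\<forall>\<^sub>F j in sequentially.
         exp (\<theta> * L / 2 * real (d j)) * real (card (microstates (right_action G (\<sigma> j)) {1..d j} A Y W' \<eta>'))
         \<le> real (card (microstates (right_action G (\<sigma> j)) {1..d j} A X W \<eta>))"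
      using sofic_eventually_regular[OF is_group sofic VM \<zeta>(1)]
    proof (rule eventually_mono)
      fix j
      let ?\<tau> = "right_action G (\<sigma> j)" and ?I = "{1..d j}" and ?n = "real (d j)"
      let ?NY = "real (card (microstates ?\<tau> ?I A Y W' \<eta>'))"
      let ?NX = "real (card (microstates ?\<tau> ?I A X W \<eta>))"
      assume irr: "real (card {a \<in> ?I. \<not> regular_at G ?\<tau> (V \<union> M) a}) \<le> \<zeta> * real (d j)"
      have perm: "?\<tau> g permutes ?I" if "g \<in> carrier G" for g
        using that by (rule right_action_permutes[OF is_group sofic])
      obtain T where T: "T \<subseteq> ?I" "separated ?\<tau> T"
        and cT: "card {a \<in> ?I. regular_at G ?\<tau> (V \<union> M) a} \<le> (card M)\<^sup>2 * card T"
      proof (rule exists_separated[of ?I ?\<tau> "V \<union> M"])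
        show "?\<tau> g permutes ?I" if "g \<in> carrier G" for g using perm[OF that] .
      qed (use M in auto)
      have "?n / 2 \<le> real (card {a \<in> ?I. regular_at G ?\<tau> (V \<union> M) a})"
      proof -
        have "card {a \<in> ?I. regular_at G ?\<tau> (V \<union> M) a} + card {a \<in> ?I. \<not> regular_at G ?\<tau> (V \<union> M) a}
            = card ({a \<in> ?I. regular_at G ?\<tau> (V \<union> M) a} \<union> {a \<in> ?I. \<not> regular_at G ?\<tau> (V \<union> M) a})"
          by (intro card_Un_disjoint[symmetric]) auto
        also have "{a \<in> ?I. regular_at G ?\<tau> (V \<union> M) a} \<union> {a \<in> ?I. \<not> regular_at G ?\<tau> (V \<union> M) a} = ?I"
          by auto
        finally have "real (card {a \<in> ?I. regular_at G ?\<tau> (V \<union> M) a})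
            + real (card {a \<in> ?I. \<not> regular_at G ?\<tau> (V \<union> M) a}) = ?n"
          by (simp only: of_nat_add[symmetric] card_atLeastAtMost diff_Suc_1)
        moreover have "\<zeta> * ?n \<le> 1 / 2 * ?n" using \<zeta>(2) by (intro mult_right_mono) auto
        ultimately show ?thesis using irr by linarith
      qed
      also have "\<dots> \<le> (real (card M))\<^sup>2 * real (card T)"
        using of_nat_mono[OF cT, where 'a = real] by simp
      finally have \<theta>T: "\<theta> * ?n \<le> real (card T)"
        using M by (simp add: \<theta>_def field_simps)
      define m where "m = nat \<lfloor>\<eta>' * real (card ?I)\<rfloor>"
      have "0 \<le> \<eta>' * real (card ?I)" using \<eta>' by simp
      note m = nat_floor_bounds[OF this, folded m_def]
      have m\<eta>0: "real m \<le> \<eta>0 * real (card ?I)"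
        by (rule order.trans[OF m(2) mult_right_mono[OF \<eta>'(3)]]) simp
      have m\<theta>: "real m \<le> \<theta> / 4 * ?n"
        using order.trans[OF m(2) mult_right_mono[OF \<eta>'(2)]] by simp
      have "exp (3 / 4 * \<theta> * L * ?n) * ?NY \<le> (1 + 1 / real (card A) ^ card E) ^ (card T - m) * ?NY"
      proof (intro mult_right_mono)
        have "3 / 4 * \<theta> * ?n \<le> real (card T) - real m" using \<theta>T m\<theta> by linarith
        also have "\<dots> \<le> real (card T - m)" by simp
        finally have "L * (3 / 4 * \<theta> * ?n) \<le> L * real (card T - m)" using L by (intro mult_left_mono) auto
        then have "exp (3 / 4 * \<theta> * L * ?n) \<le> exp (L * real (card T - m))" by (simp add: mult_ac)
        also have "\<dots> = exp L ^ (card T - m)" by (simp add: exp_of_nat_mult[symmetric] mult.commute)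
        also have "exp L = 1 + 1 / real (card A) ^ card E" using t unfolding L_def by (intro exp_ln) linarith
        finally show "exp (3 / 4 * \<theta> * L * ?n) \<le> (1 + 1 / real (card A) ^ card E) ^ (card T - m)" .
      qed simp
      also have "\<dots> = ?NY * (1 + 1 / real (card A) ^ card E) ^ (card T - m)" by (rule mult.commute)
      also have "\<dots> \<le> real (card {B. B \<subseteq> T \<and> card B \<le> m}) * ?NX"
      proof (rule patch_microstates_card[where V = V and Q = "V \<union> M" and \<zeta> = \<zeta>])
        show "?\<tau> g permutes ?I" if "g \<in> carrier G" for g using perm[OF that] .
        show "Y \<subseteq> X" "\<And>y. y \<in> Y \<Longrightarrow> \<exists>h\<in>D. y h \<noteq> p h" by (fact Y)+
      qed (use irr W A T V_def W'_def \<zeta> m in auto)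
      also have "\<dots> \<le> exp (\<theta> * L / 4 * ?n) * ?NX"
      proof (rule mult_right_mono)
        have "card {B. B \<subseteq> T \<and> card B \<le> m} \<le> card {B. B \<subseteq> ?I \<and> card B \<le> m}"
          using T by (intro card_mono) auto
        also have "real \<dots> \<le> exp (\<theta> * L / 4 * ?n)" using small[OF _ m\<eta>0] by simp
        finally show "real (card {B. B \<subseteq> T \<and> card B \<le> m}) \<le> exp (\<theta> * L / 4 * ?n)" by simp
      qed simp
      finally have le: "exp (3 / 4 * \<theta> * L * ?n) * ?NY \<le> exp (\<theta> * L / 4 * ?n) * ?NX" .
      have "exp (\<theta> * L / 4 * ?n) * (exp (\<theta> * L / 2 * ?n) * ?NY) = exp (3 / 4 * \<theta> * L * ?n) * ?NY"
      proof -
        have "\<theta> * L / 4 * ?n + \<theta> * L / 2 * ?n = 3 / 4 * \<theta> * L * ?n" by (simp add: field_simps)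
        then show ?thesis by (simp only: mult.assoc[symmetric] exp_add[symmetric])
      qed
      then have "exp (\<theta> * L / 4 * ?n) * (exp (\<theta> * L / 2 * ?n) * ?NY) \<le> exp (\<theta> * L / 4 * ?n) * ?NX"
        by (rule ord_eq_le_trans) (rule le)
      then show "exp (\<theta> * L / 2 * ?n) * ?NY \<le> ?NX"
        by (simp only: mult_le_cancel_left_pos exp_gt_zero)
    qed
    then show "\<exists>W' \<eta>'. finite W' \<and> W' \<subseteq> carrier G \<and> 0 < \<eta>' \<and> (\<forall>\<^sub>F j in sequentially.
         exp (\<theta> * L / 2 * real (d j)) * real (card (microstates (right_action G (\<sigma> j)) {1..d j} A Y W' \<eta>'))
         \<le> real (card (microstates (right_action G (\<sigma> j)) {1..d j} A X W \<eta>)))"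
      using W' \<eta>'(1) by blast
  qed
qed

text \<open>
There are at most \<open>card A ^ d j\<close> colourings, so after \<open>k\<close> steps with \<open>card A < exp (k * c)\<close> fewer than one microstate is left.
\<close>

lemma (in shift_invariant) microstates_vanish:
  assumes c: "0 < c" and d: "\<And>j. 0 < d j"
    and decay: "\<And>W \<eta>. finite W \<Longrightarrow> W \<subseteq> carrier G \<Longrightarrow> 0 < \<eta> \<Longrightarrow>
       \<exists>W' \<eta>'. finite W' \<and> W' \<subseteq> carrier G \<and> 0 < \<eta>' \<and> (\<forall>\<^sub>F j in sequentially.
         exp (c * real (d j)) * real (card (microstates (\<tau> j) {1..d j} A X W' \<eta>'))
         \<le> real (card (microstates (\<tau> j) {1..d j} A X W \<eta>)))"
  obtains W \<eta> where "finite W" "W \<subseteq> carrier G" "0 < \<eta>"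
    "\<forall>\<^sub>F j in sequentially. microstates (\<tau> j) {1..d j} A X W \<eta> = {}"
proof -
  have iter: "\<exists>W \<eta>. finite W \<and> W \<subseteq> carrier G \<and> 0 < \<eta> \<and> (\<forall>\<^sub>F j in sequentially.
      exp (real k * c * real (d j)) * real (card (microstates (\<tau> j) {1..d j} A X W \<eta>))
      \<le> real (card A) ^ d j)" for k
  proof (induction k)
    case 0
    have "real (card (microstates (\<tau> j) {1..d j} A X {} 1)) \<le> real (card A) ^ d j" for j
    proof -
      have "card (microstates (\<tau> j) {1..d j} A X {} 1) \<le> card ({1..d j} \<rightarrow>\<^sub>E A)"
        using finite_A by (intro card_mono finite_PiE) (auto simp: microstates_def)
      also have "\<dots> = card A ^ d j" by (simp add: card_PiE)
      finally show ?thesis by (metis of_nat_le_iff of_nat_power)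
    qed
    then show ?case by (intro exI[of _ "{}"] exI[of _ 1]) simp
  next
    case (Suc k)
    then obtain W \<eta> where W: "finite W" "W \<subseteq> carrier G" "0 < \<eta>" and ev: "\<forall>\<^sub>F j in sequentially.
      exp (real k * c * real (d j)) * real (card (microstates (\<tau> j) {1..d j} A X W \<eta>)) \<le> real (card A) ^ d j"
      by blast
    obtain W' \<eta>' where W': "finite W'" "W' \<subseteq> carrier G" "0 < \<eta>'" and ev': "\<forall>\<^sub>F j in sequentially.
         exp (c * real (d j)) * real (card (microstates (\<tau> j) {1..d j} A X W' \<eta>'))
         \<le> real (card (microstates (\<tau> j) {1..d j} A X W \<eta>))"
      using decay[OF W] by blast
    have "\<forall>\<^sub>F j in sequentially. exp (real (Suc k) * c * real (d j))
        * real (card (microstates (\<tau> j) {1..d j} A X W' \<eta>')) \<le> real (card A) ^ d j"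
      using ev ev'
    proof eventually_elim
      case (elim j)
      have "exp (real (Suc k) * c * real (d j)) * real (card (microstates (\<tau> j) {1..d j} A X W' \<eta>'))
          = exp (real k * c * real (d j))
            * (exp (c * real (d j)) * real (card (microstates (\<tau> j) {1..d j} A X W' \<eta>')))"
      proof -
        have "real (Suc k) * c * real (d j) = real k * c * real (d j) + c * real (d j)"
          by (simp add: algebra_simps)
        then show ?thesis by (simp only: exp_add mult.assoc)
      qed
      also have "\<dots> \<le> exp (real k * c * real (d j)) * real (card (microstates (\<tau> j) {1..d j} A X W \<eta>))"
        using elim(2) by (intro mult_left_mono) auto
      finally show ?case using elim(1) by linarith
    qed
    then show ?case using W' by blast
  qed
  obtain k where "real (card A) < real k * c" using reals_Archimedean3[OF c] by blast
  then have k: "real (card A) < exp (real k * c)"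
    using exp_ge_add_one_self[of "real k * c"] by linarith
  obtain W \<eta> where W: "finite W" "W \<subseteq> carrier G" "0 < \<eta>" and ev: "\<forall>\<^sub>F j in sequentially.
      exp (real k * c * real (d j)) * real (card (microstates (\<tau> j) {1..d j} A X W \<eta>)) \<le> real (card A) ^ d j"
    using iter by blast
  have "\<forall>\<^sub>F j in sequentially. microstates (\<tau> j) {1..d j} A X W \<eta> = {}"
    using ev
  proof (rule eventually_mono)
    fix j
    assume le: "exp (real k * c * real (d j)) * real (card (microstates (\<tau> j) {1..d j} A X W \<eta>))
      \<le> real (card A) ^ d j"
    show "microstates (\<tau> j) {1..d j} A X W \<eta> = {}"
    proof (rule ccontr)
      assume "microstates (\<tau> j) {1..d j} A X W \<eta> \<noteq> {}"
      then have "0 < card (microstates (\<tau> j) {1..d j} A X W \<eta>)"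
        by (simp add: card_gt_0_iff finite_microstates finite_A)
      then have "1 \<le> real (card (microstates (\<tau> j) {1..d j} A X W \<eta>))" by linarith
      then have "exp (real k * c * real (d j)) * 1
          \<le> exp (real k * c * real (d j)) * real (card (microstates (\<tau> j) {1..d j} A X W \<eta>))"
        by (intro mult_left_mono) auto
      then have "exp (real k * c * real (d j)) \<le> real (card A) ^ d j" using le by linarith
      moreover have "exp (real k * c * real (d j)) = exp (real k * c) ^ d j"
        by (simp add: exp_of_nat_mult[symmetric] mult.commute)
      moreover have "real (card A) ^ d j < exp (real k * c) ^ d j"
        using k d[of j] by (intro power_strict_mono) auto
      ultimately show False by simp
    qed
  qed
  then show ?thesis using that W by blast
qed

text \<open>
Nonnegative entropy enters through \<open>Map_set_nonempty\<close>. By Chebyshev's inequality the proportion of bad sites is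
at most \<open>card W * \<delta>\<^sup>2 / \<epsilon>\<^sup>2\<close>, which dictates the choice of \<open>\<delta>\<close>.
\<close>

lemma (in shift_invariant) microstates_frequently_nonempty:
  assumes sofic: "sofic_approximation G d \<sigma>" and metric: "compatible_metric G A X \<rho>"
    and K: "compact_space (subtopology (full_shift G A) X)"
    and h: "0 \<le> sofic_entropy G X \<rho> d \<sigma>"
    and W: "finite W" "W \<subseteq> carrier G" and \<eta>: "0 < \<eta>"
  shows "\<exists>\<^sub>F j in sequentially. microstates (right_action G (\<sigma> j)) {1..d j} A X W \<eta> \<noteq> {}"
proof -
  obtain \<epsilon> where \<epsilon>: "0 < \<epsilon>" "\<And>x y. x \<in> X \<Longrightarrow> y \<in> X \<Longrightarrow> \<rho> x y < \<epsilon> \<Longrightarrow> x \<one> = y \<one>"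
    using metric_determines_symbol[OF metric K X_sub one_closed] by blast
  have d: "0 < d j" for j using sofic by (simp add: sofic_approximation_def)
  define F where "F = insert \<one> ((\<lambda>h. inv h) ` W)"
  have F: "finite F" "F \<noteq> {}" "F \<subseteq> carrier G" using W by (auto simp: F_def)
  define \<delta> where "\<delta> = \<epsilon> * sqrt (\<eta> / (real (card W) + 1))"
  have \<delta>: "0 < \<delta>" using \<epsilon>(1) \<eta> by (simp add: \<delta>_def)
  have \<delta>W: "\<delta>\<^sup>2 * real (card W) \<le> \<eta> * \<epsilon>\<^sup>2"
  proof -
    have "\<delta>\<^sup>2 * real (card W) = \<eta> * \<epsilon>\<^sup>2 * (real (card W) / (real (card W) + 1))"
      using \<eta> by (simp add: \<delta>_def power_mult_distrib)
    also have "\<dots> \<le> \<eta> * \<epsilon>\<^sup>2 * 1" using \<eta> by (intro mult_left_mono) auto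
    finally show ?thesis by simp
  qed
  show ?thesis
    using Map_set_nonempty[OF h F \<delta> d]
  proof (rule frequently_elim1)
    fix j assume "Map_set G X \<rho> F \<delta> (d j) (\<sigma> j) \<noteq> {}"
    then obtain \<phi> where \<phi>: "\<phi> \<in> Map_set G X \<rho> F \<delta> (d j) (\<sigma> j)" by blast
    have "(\<lambda>a\<in>{1..d j}. \<phi> a \<one>) \<in> microstates (right_action G (\<sigma> j)) {1..d j} A X W \<eta>"
    proof (rule microstates_of_Map_set)
      show "x \<one> = y \<one>" if "x \<in> X" "y \<in> X" "\<rho> x y < \<epsilon>" for x y using \<epsilon>(2)[OF that] .
      show "\<sigma> j g permutes {1..d j}" if "g \<in> carrier G" for g
        using sofic that by (simp add: sofic_approximation_def)
      show "(\<lambda>h. inv h) ` W \<subseteq> F" by (auto simp: F_def)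
    qed (fact \<epsilon>(1) W d \<delta>W \<phi>)+
    then show "microstates (right_action G (\<sigma> j)) {1..d j} A X W \<eta> \<noteq> {}" by blast
  qed
qed

theorem corollary1p3:
  fixes G :: "('g, 'm) monoid_scheme"
    and A :: "'a set"
    and X :: "('g \<Rightarrow> 'a) set"
    and \<rho> :: "('g \<Rightarrow> 'a) \<Rightarrow> ('g \<Rightarrow> 'a) \<Rightarrow> real"
    and d :: "nat \<Rightarrow> nat"
    and \<sigma> :: "nat \<Rightarrow> 'g \<Rightarrow> nat \<Rightarrow> nat"
  assumes "finite A"
    and "group G" and "countable (carrier G)" and "sofic_group G"
    and "subshift G A X"
    and "splicable G X"
    and "strongly_irreducible G X"
    and "sofic_approximation G d \<sigma>"
    and "compatible_metric G A X \<rho>"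
    and "0 \<le> sofic_entropy G X \<rho> d \<sigma>"
  shows "surjunctive G A X"
proof -
  interpret group G by fact
  note sofic = \<open>sofic_approximation G d \<sigma>\<close>
  let ?K = "subtopology (full_shift G A) X"
  have closed: "closedin (full_shift G A) X" using \<open>subshift G A X\<close> by (simp add: subshift_def)
  have X: "X \<subseteq> carrier G \<rightarrow>\<^sub>E A" using closedin_subset[OF closed] by (simp add: topspace_full_shift)
  have K: "compact_space ?K" by (rule compact_subshift[OF \<open>finite A\<close> closed])
  have topK: "topspace ?K = X" using X by (auto simp: topspace_full_shift)
  interpret shift_invariant G A X
    using \<open>finite A\<close> X \<open>subshift G A X\<close> by unfold_locales (auto simp: subshift_def)
  have "f ` X = X"
    if f: "continuous_map ?K ?K f" and inj: "inj_on f X"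
      and equi: "\<And>g x. g \<in> carrier G \<Longrightarrow> x \<in> X \<Longrightarrow> f (shift G g x) = shift G g (f x)" for f
  proof (rule ccontr)
    assume "f ` X \<noteq> X"
    moreover have fX: "f ` X \<subseteq> X" using continuous_map_image_subset_topspace[OF f] topK by simp
    ultimately obtain p where p: "p \<in> X" "p \<notin> f ` X" by blast
    have A: "A \<noteq> {}" using X_value[OF p(1) one_closed] by blast
    have f': "continuous_map ?K (full_shift G A) f" using f by (simp add: continuous_map_in_subtopology)
    have id: "continuous_map ?K (full_shift G A) (\<lambda>x. x)" by (simp add: continuous_map_from_subtopology)
    have ext: "x = y" if "x \<in> X" "y \<in> X" "\<And>h. h \<in> carrier G \<Longrightarrow> x h = y h" for x y
      using that X by (meson PiE_ext subsetD)
    obtain N where N: "finite N" "N \<subseteq> carrier G"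
      "\<And>x y. x \<in> X \<Longrightarrow> y \<in> X \<Longrightarrow> (\<And>h. h \<in> N \<Longrightarrow> x h = y h) \<Longrightarrow> f x \<one>\<^bsub>G\<^esub> = f y \<one>\<^bsub>G\<^esub>"
    proof (rule finite_determination[OF K X id f' one_closed])
      show "f x \<one>\<^bsub>G\<^esub> = f y \<one>\<^bsub>G\<^esub>" if "x \<in> X" "y \<in> X" "\<And>h. h \<in> carrier G \<Longrightarrow> x h = y h" for x y
        using ext[OF that] by simp
    qed blast
    obtain N' where N': "finite N'" "N' \<subseteq> carrier G"
      "\<And>x y. x \<in> X \<Longrightarrow> y \<in> X \<Longrightarrow> (\<And>h. h \<in> N' \<Longrightarrow> f x h = f y h) \<Longrightarrow> x \<one>\<^bsub>G\<^esub> = y \<one>\<^bsub>G\<^esub>"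
    proof (rule finite_determination[OF K X f' id one_closed])
      show "x \<one>\<^bsub>G\<^esub> = y \<one>\<^bsub>G\<^esub>" if "x \<in> X" "y \<in> X" "\<And>h. h \<in> carrier G \<Longrightarrow> f x h = f y h" for x y
        using ext[of "f x" "f y"] that fX inj by (auto dest: inj_onD)
    qed blast
    interpret block_map G A X f N N'
    proof unfold_locales
      show "f x \<in> X" if "x \<in> X" for x using fX that by blast
      show "f (shift G g x) = shift G g (f x)" if "g \<in> carrier G" "x \<in> X" for g x
        by (rule equi[OF that])
      show "f x \<one>\<^bsub>G\<^esub> = f y \<one>\<^bsub>G\<^esub>" if "x \<in> X" "y \<in> X" "\<And>h. h \<in> N \<Longrightarrow> x h = y h" for x y
        by (rule N(3)[OF that])
      show "x \<one>\<^bsub>G\<^esub> = y \<one>\<^bsub>G\<^esub>" if "x \<in> X" "y \<in> X" "\<And>h. h \<in> N' \<Longrightarrow> f x h = f y h" for x y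
        by (rule N'(3)[OF that])
    qed (fact N(2) N'(2))+
    obtain D0 where D0: "finite D0" "D0 \<subseteq> carrier G" "\<And>y. y \<in> f ` X \<Longrightarrow> \<exists>h\<in>D0. y h \<noteq> p h"
      using missing_pattern[OF K X f' subsetD[OF X p(1)] p(2)] by blast
    \<comment> \<open>A nonempty \<open>D\<close> makes \<open>M\<close> nonempty, which the density \<open>\<theta>\<close> requires.\<close>
    define D where "D = insert \<one>\<^bsub>G\<^esub> D0"
    have D: "finite D" "D \<subseteq> carrier G" "D \<noteq> {}" using D0 by (auto simp: D_def)
    have missing: "\<exists>h\<in>D. y h \<noteq> p h" if "y \<in> f ` X" for y using D0(3)[OF that] by (auto simp: D_def)
    obtain E M where "patching G A X D E M p"
      using patchingI[OF shift_invariant_axioms \<open>splicable G X\<close> \<open>strongly_irreducible G X\<close> D(1,2) p(1)]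
      by blast
    then interpret patching G A X D E M p .
    let ?mic = "\<lambda>j X W \<eta>. real (card (microstates (right_action G (\<sigma> j)) {1..d j} A X W \<eta>))"
    obtain c where c: "0 < c" and gap: "\<And>W \<eta>. finite W \<Longrightarrow> W \<subseteq> carrier G \<Longrightarrow> 0 < \<eta> \<Longrightarrow>
       \<exists>W' \<eta>'. finite W' \<and> W' \<subseteq> carrier G \<and> 0 < \<eta>' \<and>
         (\<forall>\<^sub>F j in sequentially. exp (c * real (d j)) * ?mic j (f ` X) W' \<eta>' \<le> ?mic j X W \<eta>)"
      using missing_pattern_entropy_gap[OF sofic A D(3) fX missing] by blast
    \<comment> \<open>The gap between \<open>f ` X\<close> and \<open>X\<close> exceeds the loss under \<open>f\<close> once the latter is at most \<open>c / 2\<close>.\<close>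
    have decay: "\<exists>W' \<eta>'. finite W' \<and> W' \<subseteq> carrier G \<and> 0 < \<eta>' \<and>
         (\<forall>\<^sub>F j in sequentially. exp (c / 2 * real (d j)) * ?mic j X W' \<eta>' \<le> ?mic j X W \<eta>)"
      if W: "finite W" "W \<subseteq> carrier G" "0 < \<eta>" for W \<eta>
    proof -
      obtain W1 \<eta>1 where W1: "finite W1" "W1 \<subseteq> carrier G" "0 < \<eta>1"
        and ev1: "\<forall>\<^sub>F j in sequentially. exp (c * real (d j)) * ?mic j (f ` X) W1 \<eta>1 \<le> ?mic j X W \<eta>"
        using gap[OF W] by blast
      have "0 < c / 2" using c by simp
      then obtain W2 \<eta>2 where W2: "finite W2" "W2 \<subseteq> carrier G" "0 < \<eta>2"
        and ev2: "\<forall>\<^sub>F j in sequentially. ?mic j X W2 \<eta>2 \<le> exp (c / 2 * real (d j)) * ?mic j (f ` X) W1 \<eta>1"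
        using block_map_microstates_growth[OF sofic A N(1) N'(1) W1] by blast
      have "\<forall>\<^sub>F j in sequentially. exp (c / 2 * real (d j)) * ?mic j X W2 \<eta>2 \<le> ?mic j X W \<eta>"
        using ev1 ev2
      proof eventually_elim
        case (elim j)
        have "exp (c / 2 * real (d j)) * ?mic j X W2 \<eta>2
            \<le> exp (c / 2 * real (d j)) * (exp (c / 2 * real (d j)) * ?mic j (f ` X) W1 \<eta>1)"
          using elim(2) by (intro mult_left_mono) auto
        also have "\<dots> = exp (c * real (d j)) * ?mic j (f ` X) W1 \<eta>1"
          by (simp add: mult.assoc[symmetric] exp_add[symmetric])
        finally show ?case using elim(1) by linarith
      qed
      then show ?thesis using W2 by blast
    qed
    have d: "0 < d j" for j using sofic by (simp add: sofic_approximation_def)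
    have c2: "0 < c / 2" using c by simp
    obtain W \<eta> where W: "finite W" "W \<subseteq> carrier G" "0 < \<eta>"
      and none: "\<forall>\<^sub>F j in sequentially. microstates (right_action G (\<sigma> j)) {1..d j} A X W \<eta> = {}"
      using microstates_vanish[OF c2 d decay] by blast
    have "\<exists>\<^sub>F j in sequentially. microstates (right_action G (\<sigma> j)) {1..d j} A X W \<eta> \<noteq> {}"
      by (rule microstates_frequently_nonempty[OF sofic \<open>compatible_metric G A X \<rho>\<close> K
            \<open>0 \<le> sofic_entropy G X \<rho> d \<sigma>\<close> W])
    then show False using none by (simp add: frequently_def)
  qed
  then show ?thesis unfolding surjunctive_def by blast
qed

end
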